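(* Let $\mathcal{H}$ be a separable infinite-dimensional Hilbert space and $\mathcal{L}=\mathcal{L}(\mathcal{H})$ its space of bounded linear transformations. Then there exists a bounded analytic function $\phi:\mathbb{D}\to\mathcal{L}$ such that $$\sup_{f\in\mathcal{O}_1(\mathcal{H})}\int_{\mathbb{D}} \left\| (D\phi)(z) f(z)\right\|_{\mathcal{H}}^2(1-|z|^2)\,dA(z)<\infty,$$ while $$\sup_{f\in\mathcal{O}_1(\mathcal{H})}\int_{\mathbb{D}} \left\| (D\phi)(z) f(\overline{z})\right\|_{\mathcal{H}}^2(1-|z|^2)\,dA(z)=\infty.$$
   Context: $\mathbb{D}$ is the open unit disc in $\mathbb{C}$ and $dA$ is area measure. $\mathcal{O}_1(\mathcal{H})$ is the set of $\mathcal{H}$-valued functions $f(z)=\sum_{n\ge0}\hat f(n)z^n$ that are analytic on some disc centered at the origin of radius larger than $1$ and satisfy $\|f\|_{H^2(\mathcal{H})}^2=\sum_{n\ge0}\|\hat f(n)\|_{\mathcal{H}}^2=1$. For an analytic function $\phi(z)=\sum_{n\ge0}\hat\phi(n)z^n$ on $\mathbb{D}$, $D\phi(z)=z\phi'(z)+\phi(z)=\sum_{n\ge0}(1+n)\hat\phi(n)z^n$. Bounded means $\sup_{z\in\mathbb{D}}\|\phi(z)\|_{\mathcal{L}}<\infty$. *)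

theory Defs
  imports "HOL-Analysis.Analysis"
begin

class complex_normed_vector = real_normed_vector +
  fixes scaleC :: "complex \<Rightarrow> 'a \<Rightarrow> 'a" (infixr "*\<^sub>C" 75)
  assumes scaleC_add_right: "a *\<^sub>C (x + y) = a *\<^sub>C x + a *\<^sub>C y"
    and scaleC_add_left: "(a + b) *\<^sub>C x = a *\<^sub>C x + b *\<^sub>C x"
    and scaleC_scaleC: "a *\<^sub>C b *\<^sub>C x = (a * b) *\<^sub>C x"
    and scaleR_scaleC: "r *\<^sub>R x = complex_of_real r *\<^sub>C x"
    and norm_scaleC: "norm (a *\<^sub>C x) = cmod a * norm x"

global_interpretation complex_vector:
  vector_space "scaleC :: complex \<Rightarrow> 'a \<Rightarrow> 'a::complex_normed_vector"
  defines cspan = complex_vector.span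
proof
  show "1 *\<^sub>C x = x" for x :: 'a
    using scaleR_scaleC[of 1 x] by simp
qed (simp_all add: scaleC_add_right scaleC_add_left scaleC_scaleC)

lemma bounded_linear_scaleC: "bounded_linear (\<lambda>x :: 'a::complex_normed_vector. c *\<^sub>C x)"
  by (rule bounded_linear_intro[where K = "cmod c"])
    (simp_all add: scaleC_add_right scaleR_scaleC scaleC_scaleC norm_scaleC mult.commute)

text \<open>Complex Hilbert spaces, with inner product linear in the first argument. Positive
  definiteness follows from the last axiom.\<close>

class complex_hilbert_space = complex_normed_vector + complete_space +
  fixes cinner :: "'a \<Rightarrow> 'a \<Rightarrow> complex"
  assumes cinner_commute: "cinner x y = cnj (cinner y x)"
    and cinner_add_left: "cinner (x + y) z = cinner x z + cinner y z"
    and cinner_scaleC_left: "cinner (a *\<^sub>C x) y = a * cinner x y"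
    and cinner_self: "cinner x x = complex_of_real ((norm x)\<^sup>2)"

text \<open>The library type of bounded linear functions is only real-linear; the space of bounded
  complex-linear operators on a space is cut out of it and inherits the operator norm.\<close>

typedef (overloaded) 'a cblinop =
  "{T :: 'a::complex_normed_vector \<Rightarrow>\<^sub>L 'a.
      \<forall>c x. blinfun_apply T (c *\<^sub>C x) = c *\<^sub>C blinfun_apply T x}"
  morphisms blinfun_of_cblinop Cblinop
  by (rule exI[of _ 0]) simp

setup_lifting type_definition_cblinop

lift_definition cblinop_apply :: "'a::complex_normed_vector cblinop \<Rightarrow> 'a \<Rightarrow> 'a"
  is blinfun_apply .

instantiation cblinop :: (complex_normed_vector) complex_normed_vector
begin

lift_definition norm_cblinop :: "'a cblinop \<Rightarrow> real" is norm .

lift_definition zero_cblinop :: "'a cblinop" is 0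
  by simp

lift_definition plus_cblinop :: "'a cblinop \<Rightarrow> 'a cblinop \<Rightarrow> 'a cblinop" is "(+)"
  by (simp add: plus_blinfun.rep_eq scaleC_add_right)

lift_definition minus_cblinop :: "'a cblinop \<Rightarrow> 'a cblinop \<Rightarrow> 'a cblinop" is "(-)"
  by (simp add: minus_blinfun.rep_eq complex_vector.scale_right_diff_distrib)

lift_definition uminus_cblinop :: "'a cblinop \<Rightarrow> 'a cblinop" is uminus
  by (simp add: uminus_blinfun.rep_eq)

lift_definition scaleR_cblinop :: "real \<Rightarrow> 'a cblinop \<Rightarrow> 'a cblinop" is scaleR
  by (simp add: scaleR_blinfun.rep_eq scaleR_scaleC mult.commute)

lift_definition scaleC_cblinop :: "complex \<Rightarrow> 'a cblinop \<Rightarrow> 'a cblinop"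
  is "\<lambda>c T. Blinfun (\<lambda>x. c *\<^sub>C blinfun_apply T x)"
  by (simp add: bounded_linear_Blinfun_apply mult.commute
      bounded_linear_compose[OF bounded_linear_scaleC blinfun.bounded_linear_right])

definition dist_cblinop :: "'a cblinop \<Rightarrow> 'a cblinop \<Rightarrow> real"
  where "dist_cblinop S T = norm (S - T)"

definition sgn_cblinop :: "'a cblinop \<Rightarrow> 'a cblinop"
  where "sgn_cblinop T = inverse (norm T) *\<^sub>R T"

definition uniformity_cblinop :: "('a cblinop \<times> 'a cblinop) filter"
  where "uniformity_cblinop = (INF e\<in>{0<..}. principal {(S, T). dist S T < e})"

definition open_cblinop :: "'a cblinop set \<Rightarrow> bool"
  where "open_cblinop U = (\<forall>S\<in>U. \<forall>\<^sub>F (S', T) in uniformity. S' = S \<longrightarrow> T \<in> U)"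

lemma cblinop_apply_scaleC [simp]:
  "cblinop_apply (c *\<^sub>C T) x = c *\<^sub>C cblinop_apply T x" for T :: "'a cblinop"
proof transfer
  fix c :: complex and T :: "'a \<Rightarrow>\<^sub>L 'a" and x
  have "bounded_linear (\<lambda>x. c *\<^sub>C blinfun_apply T x)"
    by (rule bounded_linear_compose[OF bounded_linear_scaleC blinfun.bounded_linear_right])
  then show "blinfun_apply (Blinfun (\<lambda>x. c *\<^sub>C blinfun_apply T x)) x = c *\<^sub>C blinfun_apply T x"
    by (simp add: bounded_linear_Blinfun_apply)
qed

lemma cblinop_eqI: "(\<And>x. cblinop_apply S x = cblinop_apply T x) \<Longrightarrow> S = T" for S T :: "'a cblinop"
  by transfer (rule blinfun_eqI)

lemma cblinop_apply_add: "cblinop_apply (S + T) x = cblinop_apply S x + cblinop_apply T x"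
  for S T :: "'a cblinop"
  by transfer (simp add: plus_blinfun.rep_eq)

lemma norm_cblinop_onorm: "norm T = onorm (cblinop_apply T)" for T :: "'a cblinop"
  by transfer (simp add: norm_blinfun.rep_eq)

lemma cblinop_apply_scaleR: "cblinop_apply (r *\<^sub>R T) x = r *\<^sub>R cblinop_apply T x"
  for T :: "'a cblinop"
  by transfer (simp add: scaleR_blinfun.rep_eq)

instance
proof
  fix a b :: complex and r s :: real and S T U :: "'a cblinop"
  show "S + T + U = S + (T + U)" "S + T = T + S" "0 + S = S" "- S + S = 0" "S - T = S + - T"
    "r *\<^sub>R (S + T) = r *\<^sub>R S + r *\<^sub>R T" "(r + s) *\<^sub>R S = r *\<^sub>R S + s *\<^sub>R S"
    "r *\<^sub>R s *\<^sub>R S = (r * s) *\<^sub>R S" "1 *\<^sub>R S = S"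
    "(norm S = 0) = (S = 0)" "norm (S + T) \<le> norm S + norm T"
    "norm (r *\<^sub>R S) = \<bar>r\<bar> * norm S"
    by (transfer; simp add: algebra_simps norm_triangle_ineq)+
  show "a *\<^sub>C (S + T) = a *\<^sub>C S + a *\<^sub>C T" "(a + b) *\<^sub>C S = a *\<^sub>C S + b *\<^sub>C S"
    "a *\<^sub>C b *\<^sub>C S = (a * b) *\<^sub>C S" "r *\<^sub>R S = complex_of_real r *\<^sub>C S"
    by (rule cblinop_eqI; simp add: cblinop_apply_add cblinop_apply_scaleR scaleC_add_right
        scaleC_add_left scaleR_scaleC)+
  show "norm (a *\<^sub>C S) = cmod a * norm S"
  proof -
    have "onorm (\<lambda>x. a *\<^sub>C cblinop_apply S x) = onorm (\<lambda>x. cmod a *\<^sub>R cblinop_apply S x)"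
      by (simp add: onorm_def norm_scaleC)
    also have "\<dots> = \<bar>cmod a\<bar> * onorm (cblinop_apply S)"
      by (rule onorm_scaleR) (simp add: cblinop_apply.rep_eq blinfun.bounded_linear_right)
    finally show ?thesis
      by (simp add: norm_cblinop_onorm cblinop_apply_scaleC[abs_def])
  qed
qed (simp_all only: dist_cblinop_def sgn_cblinop_def uniformity_cblinop_def open_cblinop_def)

end

text \<open>Analyticity of a vector-valued function on a disc centred at the origin, through its power
  series; the series converges in norm (for operator-valued functions, in operator norm).\<close>

definition has_power_series_on_disc ::
    "(complex \<Rightarrow> 'b::complex_normed_vector) \<Rightarrow> (nat \<Rightarrow> 'b) \<Rightarrow> real \<Rightarrow> bool"
  where "has_power_series_on_disc f c R \<longleftrightarrow> (\<forall>z\<in>ball 0 R. (\<lambda>n. z ^ n *\<^sub>C c n) sums f z)"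

definition analytic_on_disc :: "(complex \<Rightarrow> 'b::complex_normed_vector) \<Rightarrow> real \<Rightarrow> bool"
  where "analytic_on_disc f R \<longleftrightarrow> (\<exists>c. has_power_series_on_disc f c R)"

definition cderiv :: "(complex \<Rightarrow> 'b::complex_normed_vector) \<Rightarrow> complex \<Rightarrow> 'b"
  where "cderiv f z = (SOME d. (f has_derivative (\<lambda>h. h *\<^sub>C d)) (at z))"

definition D_op :: "(complex \<Rightarrow> 'b::complex_normed_vector) \<Rightarrow> complex \<Rightarrow> 'b"
  where "D_op \<phi> z = z *\<^sub>C cderiv \<phi> z + \<phi> z"

definition O1 :: "(complex \<Rightarrow> 'a::complex_hilbert_space) set"
  where "O1 = {f. \<exists>c R. R > 1 \<and> has_power_series_on_disc f c R \<and> (\<lambda>n. (norm (c n))\<^sup>2) sums 1}"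

end

theory Submission
  imports Defs
begin

text \<open>Let \<open>e\<^sub>0, e\<^sub>1, \<dots>\<close> be orthonormal, \<open>U(z) = diag(z ^ 4 ^ k)\<close> in these coordinates, and let \<open>H\<close> be
  Hilbert's matrix \<open>(1 / (k - m))\<close> with zero diagonal, which is bounded although its lower
  triangular part is not. The symbol is \<open>\<phi>(z) = U(z) H U(z)\<close>.

  In \<open>(D\<phi>)(z) f(z)\<close> the weight \<open>1 + 4 ^ k + 4 ^ m\<close> of the entry \<open>(k, m)\<close> splits additively, so the full
  matrix \<open>H\<close> acts in each part and only its boundedness is needed. In \<open>(D\<phi>)(z) f(cnj z)\<close> with
  \<open>f = N ^ (-1/2) \<Sum>\<^sub>m z ^ 4 ^ m e\<^sub>m\<close> the frequencies of \<open>U\<close> and \<open>f\<close> cancel to \<open>|z| ^ (2 * 4 ^ m)\<close>, which where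
  \<open>1 - |z|\<close> is about \<open>4 ^ (-k)\<close> suppresses the entries with \<open>m > k\<close> of row \<open>k\<close>. The triangular
  truncation remains and contributes a factor \<open>log k\<close>.\<close>

subsection \<open>Integrals over the unit disc\<close>

text \<open>At one fixed radius nothing blows up: without the weights, the row sums
  \<open>\<Sum>m. z ^ 4 ^ m * f m / (k - m)\<close> are controlled in square sum by the norm of the
  full matrix, whatever the phases. Growth must come from the interplay of rows and radii. Row
  \<open>k\<close> carries the factor \<open>4 ^ k * z ^ 4 ^ k\<close> and thus weighs essentially
  the annulus where \<open>1 - |z|\<close> is about \<open>4 ^ (-k)\<close>, so different rows see
  different radii. For \<open>f (cnj z)\<close> the radius decides which columns survive, and
  letting the radius move with the row is what produces the triangular truncation. For
  \<open>f z\<close> the row sums are analytic. Their \<open>H^2\<close> norms are added frequency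
  by frequency with the full matrix, and multiplication by \<open>a * z ^ a\<close> maps
  \<open>H^2\<close> into \<open>L^2((1 - |z|^2) dA)\<close> with a norm bounded independently of
  \<open>a\<close>. Hence every row may have its own annulus at no cost.\<close>

text \<open>Up to a null set an open set is a countable disjoint union of balls (Vitali), and a rotation
  maps balls to balls of the same radius.\<close>

lemma emeasure_lborel_open_le_vimage_mult:
  fixes c :: complex
  assumes c: "cmod c = 1" and U: "open U"
  shows "emeasure lborel U \<le> emeasure lborel ((*) c -` U)"
proof -
  define K where "K = {(x, r). r > 0 \<and> ball x r \<subseteq> U}"
  have "\<exists>i. i \<in> K \<and> x \<in> ball (fst i) (snd i) \<and> snd i < d" if "x \<in> U" "0 < d" for x d
  proof -
    obtain e where e: "e > 0" "ball x e \<subseteq> U"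
      using U \<open>x \<in> U\<close> open_contains_ball by blast
    then have "ball x (min e (d / 2)) \<subseteq> U"
      by auto
    then show ?thesis
      using e \<open>0 < d\<close> by (intro exI[of _ "(x, min e (d / 2))"]) (auto simp: K_def)
  qed
  then obtain C where C: "countable C" "C \<subseteq> K"
    and disj: "pairwise (\<lambda>i j. disjnt (ball (fst i) (snd i)) (ball (fst j) (snd j))) C"
    and neg: "negligible (U - (\<Union>i\<in>C. ball (fst i) (snd i)))"
    using Vitali_covering_theorem_balls[of U K fst snd] by blast
  define B where "B = (\<lambda>i::complex \<times> real. ball (fst i) (snd i))"
  have B_vimage: "(*) c -` B i = ball (fst i / c) (snd i)" for i
  proof -
    have "c \<noteq> 0"
      using c by auto
    then have "dist (fst i / c) w = dist (fst i) (c * w)" for w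
    proof -
      have "dist (fst i) (c * w) = cmod (c * (fst i / c - w))"
        using \<open>c \<noteq> 0\<close> by (simp add: dist_norm right_diff_distrib)
      then show ?thesis
        using c by (simp add: dist_norm norm_mult)
    qed
    then show ?thesis
      by (auto simp: B_def)
  qed
  have BU: "(\<Union>i\<in>C. B i) \<subseteq> U"
    using C(2) by (fastforce simp: K_def B_def)
  have disjB: "disjoint_family_on B C"
    using disj by (auto simp: disjoint_family_on_def pairwise_def disjnt_def B_def)
  have open_UN: "open (\<Union>i\<in>C. B i)"
    by (auto simp: B_def)
  have "U - (\<Union>i\<in>C. B i) \<in> sets lborel"
    using open_UN U by (simp add: borel_open sets.Diff)
  moreover have "U - (\<Union>i\<in>C. B i) \<in> null_sets lebesgue"
    using neg by (simp only: negligible_iff_null_sets B_def)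
  ultimately have null: "emeasure lborel (U - (\<Union>i\<in>C. B i)) = 0"
    using null_sets_completion_iff null_setsD1 by blast
  have "emeasure lborel U = emeasure lborel ((\<Union>i\<in>C. B i) \<union> (U - (\<Union>i\<in>C. B i)))"
    using BU by (intro arg_cong[of _ _ "emeasure lborel"]) auto
  also have "\<dots> \<le> emeasure lborel (\<Union>i\<in>C. B i) + emeasure lborel (U - (\<Union>i\<in>C. B i))"
    using open_UN U by (intro emeasure_subadditive) auto
  also have "\<dots> = (\<integral>\<^sup>+i. emeasure lborel (B i) \<partial>count_space C)"
  proof -
    have "emeasure lborel (\<Union>i\<in>C. B i) = (\<integral>\<^sup>+i. emeasure lborel (B i) \<partial>count_space C)"
      using C(1) disjB by (intro emeasure_UN_countable) (auto simp: B_def)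
    then show ?thesis
      by (simp only: null add_0_right)
  qed
  also have "\<dots> = (\<integral>\<^sup>+i. emeasure lborel ((*) c -` B i) \<partial>count_space C)"
    using C(2) unfolding B_vimage
    by (intro nn_integral_cong) (auto simp: B_def K_def emeasure_ball)
  also have "\<dots> = emeasure lborel (\<Union>i\<in>C. (*) c -` B i)"
  proof (rule emeasure_UN_countable[symmetric, OF _ C(1)])
    show "disjoint_family_on (\<lambda>i. (*) c -` B i) C"
      using disjB by (fastforce simp: disjoint_family_on_def)
  qed (simp add: B_vimage)
  also have "\<dots> \<le> emeasure lborel ((*) c -` U)"
    using BU U by (intro emeasure_mono) (auto intro!: borel_open open_vimage continuous_intros)
  finally show ?thesis .
qed

text \<open>The preceding inequality for \<open>c\<close>, and again for \<open>1 / c\<close> on the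
  preimage, gives equality on boxes, which determine Lebesgue measure. Rotation invariance replaces
  polar coordinates below: averaging over rotations supplies the angular integral, areas of annuli
  the radial one.\<close>

lemma lborel_distr_mult_unit:
  assumes c: "cmod c = 1"
  shows "distr lborel borel ((*) c) = (lborel :: complex measure)"
proof (rule lborel_eqI[symmetric])
  fix l u :: complex
  assume lu: "\<And>b. b \<in> Basis \<Longrightarrow> l \<bullet> b \<le> u \<bullet> b"
  have opn: "open ((*) c -` box l u)"
    by (intro open_vimage continuous_intros open_box)
  have "c \<noteq> 0"
    using c by auto
  then have "(*) (1 / c) -` ((*) c -` box l u) = box l u"
    by auto
  moreover have "cmod (1 / c) = 1"
    using c by (simp add: norm_divide)
  ultimately have "emeasure lborel ((*) c -` box l u) = emeasure lborel (box l u)"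
    using emeasure_lborel_open_le_vimage_mult[OF c open_box, of l u]
      emeasure_lborel_open_le_vimage_mult[OF _ opn, of "1 / c"] by (simp add: antisym)
  then show "emeasure (distr lborel borel ((*) c)) (box l u) = (\<Prod>b\<in>Basis. (u - l) \<bullet> b)"
    using lu by (simp add: emeasure_distr emeasure_lborel_box)
qed simp

lemma emeasure_annulus:
  assumes "0 \<le> s" "s \<le> t"
  shows "emeasure lborel {z::complex. s < (cmod z)\<^sup>2 \<and> (cmod z)\<^sup>2 < t} = ennreal (pi * (t - s))"
proof -
  have "sqrt s < cmod z \<longleftrightarrow> s < (cmod z)\<^sup>2" "cmod z < sqrt t \<longleftrightarrow> (cmod z)\<^sup>2 < t" for z
    using real_sqrt_less_iff[of s "(cmod z)\<^sup>2"] real_sqrt_less_iff[of "(cmod z)\<^sup>2" t] by simp_all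
  then have eq: "{z::complex. s < (cmod z)\<^sup>2 \<and> (cmod z)\<^sup>2 < t} = ball 0 (sqrt t) - cball 0 (sqrt s)"
    by (intro set_eqI) (simp add: not_le conj_commute)
  show ?thesis
  proof (cases "s = t")
    case True
    then have "{z::complex. s < (cmod z)\<^sup>2 \<and> (cmod z)\<^sup>2 < t} = {}"
      by auto
    then have "emeasure lborel {z::complex. s < (cmod z)\<^sup>2 \<and> (cmod z)\<^sup>2 < t} = 0"
      by (simp only: emeasure_empty)
    then show ?thesis
      using True by simp
  next
    case False
    then have "sqrt s < sqrt t"
      using assms by simp
    then have sub: "cball 0 (sqrt s) \<subseteq> (ball 0 (sqrt t) :: complex set)"
      by (auto simp del: real_sqrt_less_iff)
    have "emeasure lborel (ball 0 (sqrt t) - cball 0 (sqrt s) :: complex set)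
        = emeasure lborel (ball 0 (sqrt t) :: complex set) - emeasure lborel (cball 0 (sqrt s) :: complex set)"
      by (rule emeasure_Diff) (use sub emeasure_lborel_cball_finite[of "0::complex" "sqrt s"] in auto)
    also have "\<dots> = ennreal (pi * t) - ennreal (pi * s)"
      using assms by (simp add: emeasure_ball emeasure_cball unit_ball_vol_2)
    finally show ?thesis
      using assms unfolding eq by (simp add: ennreal_minus right_diff_distrib)
  qed
qed

text \<open>Under area measure on the unit disc, the squared modulus is uniformly distributed.\<close>

lemma nn_integral_disc_radial:
  fixes g :: "real \<Rightarrow> ennreal"
  assumes [measurable]: "g \<in> borel_measurable borel"
  shows "(\<integral>\<^sup>+z\<in>ball 0 1. g ((cmod z)\<^sup>2) \<partial>lborel) = ennreal pi * (\<integral>\<^sup>+t\<in>{0..<1}. g t \<partial>lborel)"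
proof -
  define M where "M = distr (density lborel (indicator (ball (0::complex) 1))) borel (\<lambda>z. (cmod z)\<^sup>2)"
  define N where "N = density lborel (\<lambda>t::real. ennreal pi * indicator {0..<1} t)"
  have M: "emeasure M {x<..} = emeasure lborel (ball (0::complex) 1 \<inter> {z. x < (cmod z)\<^sup>2})" for x
  proof -
    have [measurable]: "{z::complex. x < (cmod z)\<^sup>2} \<in> sets borel"
      by (intro borel_open open_Collect_less continuous_intros)
    have "emeasure M {x<..}
        = emeasure (density lborel (indicator (ball (0::complex) 1))) {z. x < (cmod z)\<^sup>2}"
      unfolding M_def by (subst emeasure_distr) (auto simp: vimage_def)
    also have "\<dots> = (\<integral>\<^sup>+z. indicator (ball (0::complex) 1 \<inter> {z. x < (cmod z)\<^sup>2}) z \<partial>lborel)"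
      by (subst emeasure_density) (auto simp: indicator_inter_arith[abs_def]
          intro!: borel_measurable_indicator)
    also have "\<dots> = emeasure lborel (ball (0::complex) 1 \<inter> {z. x < (cmod z)\<^sup>2})"
      by (rule nn_integral_indicator) auto
    finally show ?thesis .
  qed
  have N: "emeasure N {x<..} = ennreal pi * emeasure lborel ({x<..} \<inter> {0..<1})" for x
  proof -
    have "emeasure N {x<..} = (\<integral>\<^sup>+t. ennreal pi * indicator ({x<..} \<inter> {0..<1}) t \<partial>lborel)"
      unfolding N_def by (subst emeasure_density) (auto simp: indicator_inter_arith mult_ac)
    also have "\<dots> = ennreal pi * emeasure lborel ({x<..} \<inter> {0..<1})"
      by (rule nn_integral_cmult_indicator) auto
    finally show ?thesis .
  qed
  have "M = N"
  proof (rule measure_eqI_lessThan)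
    fix x :: real
    \<comment> \<open>Clamping \<open>x\<close> to the unit interval lets one formula cover rays
      that contain the whole mass, cut it, or miss it.\<close>
    have "emeasure M {x<..} = ennreal (pi * (1 - min 1 (max 0 x)))"
    proof (cases "x < 0")
      case True
      then have "ball (0::complex) 1 \<inter> {z. x < (cmod z)\<^sup>2} = ball 0 1"
        by (auto intro: less_le_trans)
      then show ?thesis
        using True by (simp add: M emeasure_ball unit_ball_vol_2)
    next
      case False
      have "ball (0::complex) 1 \<inter> {z. x < (cmod z)\<^sup>2} = {z. x < (cmod z)\<^sup>2 \<and> (cmod z)\<^sup>2 < 1}"
        by (auto simp: abs_square_less_1)
      moreover have "{z::complex. x < (cmod z)\<^sup>2 \<and> (cmod z)\<^sup>2 < 1} = {}" if "x \<ge> 1"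
        using that by auto
      ultimately show ?thesis
        using False emeasure_annulus[of x 1] by (cases "x \<ge> 1") (simp_all add: M)
    qed
    moreover have "emeasure N {x<..} = ennreal (pi * (1 - min 1 (max 0 x)))"
    proof -
      have "{x<..} \<inter> {0..<1} = (if x < 0 then {0..<1} else if x < 1 then {x<..<1} else {})"
        by auto
      then show ?thesis
        by (auto simp: N ennreal_mult[symmetric])
    qed
    ultimately show "emeasure M {x<..} = emeasure N {x<..}" "emeasure M {x<..} < \<infinity>"
      by simp_all
  qed (simp_all add: M_def N_def)
  have "(\<integral>\<^sup>+z\<in>ball 0 1. g ((cmod z)\<^sup>2) \<partial>lborel) = (\<integral>\<^sup>+t. g t \<partial>M)"
  proof -
    have "(\<integral>\<^sup>+t. g t \<partial>M) = (\<integral>\<^sup>+z. g ((cmod z)\<^sup>2) \<partial>density lborel (indicator (ball (0::complex) 1)))"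
      unfolding M_def by (rule nn_integral_distr) auto
    also have "\<dots> = (\<integral>\<^sup>+z. indicator (ball 0 1) z * g ((cmod z)\<^sup>2) \<partial>lborel)"
      by (rule nn_integral_density) (auto intro!: borel_measurable_indicator)
    finally show ?thesis
      by (simp add: mult.commute)
  qed
  also have "\<dots> = ennreal pi * (\<integral>\<^sup>+t\<in>{0..<1}. g t \<partial>lborel)"
    unfolding \<open>M = N\<close> N_def
    by (simp add: nn_integral_density nn_integral_cmult[symmetric] ac_simps)
  finally show ?thesis .
qed

text \<open>A Beta integral in the variable \<open>t = |z|^2\<close>. The decay of order
  \<open>1 / q^2\<close> is exactly what absorbs the squared weight of a derivative.\<close>

lemma nn_integral_disc_moment:
  "(\<integral>\<^sup>+z\<in>ball 0 1. ennreal ((cmod z) ^ (2 * q) * (1 - (cmod z)\<^sup>2)) \<partial>lborel)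
    = ennreal (pi / ((real q + 1) * (real q + 2)))"
proof -
  have "((\<lambda>t. t ^ q * (1 - t)) has_integral
      ((1::real) ^ (q + 1) / (real q + 1) - 1 ^ (q + 2) / (real q + 2)
        - (0 ^ (q + 1) / (real q + 1) - 0 ^ (q + 2) / (real q + 2)))) {0..1}"
  proof (rule fundamental_theorem_of_calculus)
    fix t :: real
    have pow: "((\<lambda>t. t ^ Suc n / real (Suc n)) has_real_derivative t ^ n) (at t within {0..1})" for n
      using DERIV_cdivide[OF DERIV_power[OF DERIV_ident, of "Suc n" t "{0..1}"], of "real (Suc n)"]
      by (simp del: power_Suc of_nat_Suc)
    show "((\<lambda>t. t ^ (q + 1) / (real q + 1) - t ^ (q + 2) / (real q + 2)) has_vector_derivative
        t ^ q * (1 - t)) (at t within {0..1})"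
      unfolding has_real_derivative_iff_has_vector_derivative[symmetric]
      using DERIV_diff[OF pow[of q] pow[of "Suc q"]] by (simp add: algebra_simps)
  qed simp
  moreover have "(1::real) ^ (q + 1) / (real q + 1) - 1 ^ (q + 2) / (real q + 2)
      - (0 ^ (q + 1) / (real q + 1) - 0 ^ (q + 2) / (real q + 2)) = 1 / ((real q + 1) * (real q + 2))"
    by (simp add: field_simps)
  ultimately have I: "((\<lambda>t. t ^ q * (1 - t)) has_integral 1 / ((real q + 1) * (real q + 2))) {0..1}"
    by (simp only:)
  have "(\<integral>\<^sup>+t\<in>{0..<1}. ennreal (t ^ q * (1 - t)) \<partial>lborel)
      = (\<integral>\<^sup>+t\<in>{0..1}. ennreal (t ^ q * (1 - t)) \<partial>lborel)"
    by (intro nn_integral_cong) (auto simp: indicator_def)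
  also have "\<dots> = ennreal (1 / ((real q + 1) * (real q + 2)))"
    by (rule nn_integral_has_integral_lebesgue'[OF _ I]) auto
  finally have *: "(\<integral>\<^sup>+t\<in>{0..<1}. ennreal (t ^ q * (1 - t)) \<partial>lborel)
      = ennreal (1 / ((real q + 1) * (real q + 2)))" .
  have "(\<integral>\<^sup>+z\<in>ball 0 1. ennreal ((cmod z) ^ (2 * q) * (1 - (cmod z)\<^sup>2)) \<partial>lborel)
      = (\<integral>\<^sup>+z\<in>ball 0 1. ennreal (((cmod z)\<^sup>2) ^ q * (1 - (cmod z)\<^sup>2)) \<partial>lborel)"
    by (simp add: power_mult)
  also have "\<dots> = ennreal pi * (\<integral>\<^sup>+t\<in>{0..<1}. ennreal (t ^ q * (1 - t)) \<partial>lborel)"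
    by (rule nn_integral_disc_radial) simp
  finally show ?thesis
    by (simp add: * ennreal_mult[symmetric])
qed

section \<open>Fourier orthogonality on circles and weighted norms of analytic polynomials\<close>

lemma has_integral_cis_int:
  "((\<lambda>t. cis (of_int j * t)) has_integral (if j = 0 then 2 * pi else 0)) {0..2 * pi}"
proof (cases "j = 0")
  case True
  then show ?thesis
    using has_integral_const_real[of "1::complex" 0 "2 * pi"] by (simp add: scaleR_conv_of_real)
next
  case False
  have "((\<lambda>t. cis (of_int j * t)) has_integral
      cis (of_int j * (2 * pi)) / (\<i> * of_int j) - cis (of_int j * 0) / (\<i> * of_int j)) {0..2 * pi}"
  proof (rule fundamental_theorem_of_calculus)
    fix t
    have "((\<lambda>z. exp (\<i> * (of_int j * z)) / (\<i> * of_int j)) has_field_derivative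
        exp (\<i> * (of_int j * of_real t))) (at (of_real t))"
      using False by (auto intro!: derivative_eq_intros) (simp add: mult_ac)
    then show "((\<lambda>t. cis (of_int j * t) / (\<i> * of_int j)) has_vector_derivative cis (of_int j * t))
        (at t within {0..2 * pi})"
      using has_vector_derivative_real_field by (simp add: cis_conv_exp)
  qed simp
  moreover have "cis (of_int j * (2 * pi)) = 1"
    by (metis cis_multiple_2pi mult.commute Ints_of_int)
  ultimately show ?thesis
    using False by simp
qed

lemma has_integral_trig_poly_norm:
  fixes p :: "nat \<Rightarrow> complex"
  shows "((\<lambda>t. (cmod (\<Sum>n<N. p n * cis (real n * t)))\<^sup>2) has_integral
    2 * pi * (\<Sum>n<N. (cmod (p n))\<^sup>2)) {0..2 * pi}"
proof -
  have "((\<lambda>t. \<Sum>n<N. \<Sum>m<N. p n * cnj (p m) * cis (of_int (int n - int m) * t)) has_integral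
      (\<Sum>n<N. \<Sum>m<N. p n * cnj (p m) * (if int n - int m = 0 then 2 * pi else 0))) {0..2 * pi}"
    by (intro has_integral_sum has_integral_mult_right has_integral_cis_int) auto
  moreover have "(\<Sum>n<N. \<Sum>m<N. p n * cnj (p m) * (if int n - int m = 0 then 2 * pi else 0))
      = of_real (2 * pi * (\<Sum>n<N. (cmod (p n))\<^sup>2))"
    by (simp add: if_distrib[of "\<lambda>x. _ * of_real x"] sum.delta complex_norm_square[symmetric]
        sum_distrib_left mult.commute cong: if_cong)
  moreover have "(\<Sum>n<N. \<Sum>m<N. p n * cnj (p m) * cis (of_int (int n - int m) * t))
      = of_real ((cmod (\<Sum>n<N. p n * cis (real n * t)))\<^sup>2)" for t
    unfolding complex_norm_square
    by (simp add: sum_product cnj_sum cis_cnj cis_mult algebra_simps)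
  ultimately have "((\<lambda>t. complex_of_real ((cmod (\<Sum>n<N. p n * cis (real n * t)))\<^sup>2)) has_integral
    of_real (2 * pi * (\<Sum>n<N. (cmod (p n))\<^sup>2))) {0..2 * pi}"
    by simp
  from has_integral_Re[OF this] show ?thesis
    by simp
qed

lemma nn_integral_lborel_mult_unit:
  assumes [measurable]: "g \<in> borel_measurable borel" and c: "cmod c = 1"
  shows "(\<integral>\<^sup>+z. g (c * z) \<partial>lborel) = (\<integral>\<^sup>+z. g z \<partial>(lborel :: complex measure))"
  by (subst (2) lborel_distr_mult_unit[OF c, symmetric]) (simp add: nn_integral_distr)

text \<open>A Littlewood-Paley type estimate, uniform in \<open>a\<close>. The monomials
  \<open>z ^ (a + n)\<close> remain orthogonal on every circle, and the weighted square norm of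
  \<open>a * z ^ (a + n)\<close> is \<open>pi * a^2 / ((a + n + 1) * (a + n + 2))\<close>, at most
  \<open>pi\<close>.\<close>

lemma nn_integral_disc_poly:
  fixes p :: "nat \<Rightarrow> complex"
  shows "(\<integral>\<^sup>+z\<in>ball 0 1. ennreal ((real a * cmod (z ^ a * (\<Sum>n<N. p n * z ^ n)))\<^sup>2
      * (1 - (cmod z)\<^sup>2)) \<partial>lborel) \<le> ennreal (pi * (\<Sum>n<N. (cmod (p n))\<^sup>2))"
proof -
  define w where "w = (\<lambda>z. real a ^ 2 * (cmod z) ^ (2 * a) * (1 - (cmod z)\<^sup>2))"
  define P where "P = (\<lambda>z. (cmod (\<Sum>n<N. p n * z ^ n))\<^sup>2)"
  define G where "G = (\<lambda>z. ennreal (w z * P z) * indicator (ball 0 1) z)"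
  have w_nonneg: "w z \<ge> 0" if "z \<in> ball 0 1" for z
    using that by (auto simp: w_def abs_square_le_1 intro!: mult_nonneg_nonneg)
  have [measurable]: "w \<in> borel_measurable borel" "P \<in> borel_measurable borel"
    unfolding w_def P_def by (auto intro!: borel_measurable_continuous_onI continuous_intros)
  have [measurable]: "ball (0::complex) 1 \<in> sets borel"
    by simp
  have [measurable]: "G \<in> borel_measurable borel"
    unfolding G_def by simp
  have [measurable]: "(\<lambda>(t, z). G (cis t * z)) \<in> borel_measurable (lborel \<Otimes>\<^sub>M lborel)"
  proof -
    have "(\<lambda>x. cis (fst x) * snd x) \<in> borel_measurable (borel :: (real \<times> complex) measure)"
      by (auto intro!: borel_measurable_continuous_onI continuous_intros simp: cis_conv_exp)
    then have "(\<lambda>x. cis (fst x) * snd x) \<in> borel_measurable (lborel \<Otimes>\<^sub>M lborel)"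
      by (simp add: lborel_prod)
    from measurable_compose[OF this, of G borel] show ?thesis
      by (simp add: case_prod_beta)
  qed
  have G_rot: "G (cis t * z) = ennreal (w z) * ennreal (P (cis t * z)) * indicator (ball 0 1) z" for t z
    by (auto simp: G_def w_def norm_mult indicator_def ennreal_mult'' P_def split: if_splits)
  have circle: "(\<integral>\<^sup>+t\<in>{0..2 * pi}. ennreal (P (cis t * z)) \<partial>lborel)
      = ennreal (2 * pi * (\<Sum>n<N. (cmod (p n))\<^sup>2 * cmod z ^ (2 * n)))" for z
  proof -
    have "((\<lambda>t. P (cis t * z)) has_integral 2 * pi * (\<Sum>n<N. (cmod (p n))\<^sup>2 * cmod z ^ (2 * n))) {0..2 * pi}"
    proof -
      have "P (cis t * z) = (cmod (\<Sum>n<N. p n * z ^ n * cis (real n * t)))\<^sup>2" for t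
        unfolding P_def power_mult_distrib Complex.DeMoivre by (simp only: mult_ac)
      moreover have "(\<Sum>n<N. (cmod (p n * z ^ n))\<^sup>2) = (\<Sum>n<N. (cmod (p n))\<^sup>2 * cmod z ^ (2 * n))"
        by (simp add: norm_mult norm_power power_mult_distrib power_even_eq)
      ultimately show ?thesis
        using has_integral_trig_poly_norm[where N = N and p = "\<lambda>n. p n * z ^ n"] by simp
    qed
    then show ?thesis
      by (intro nn_integral_has_integral_lebesgue') (auto simp: P_def)
  qed
  \<comment> \<open>The integral of \<open>G\<close> does not change under rotation, so it may be
    averaged over all angles \<open>t\<close>. After Fubini the inner integral runs over a circle,
    where only \<open>P\<close> varies and Parseval removes the cross terms.\<close>
  have "ennreal (2 * pi) * (\<integral>\<^sup>+z. G z \<partial>lborel)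
      = (\<integral>\<^sup>+t\<in>{0..2 * pi}. (\<integral>\<^sup>+z. G z \<partial>lborel) \<partial>lborel)"
    by (subst nn_integral_cmult_indicator) (auto simp: mult.commute)
  also have "\<dots> = (\<integral>\<^sup>+t. \<integral>\<^sup>+z. G (cis t * z) * indicator {0..2 * pi} t \<partial>lborel \<partial>lborel)"
    by (simp add: nn_integral_multc nn_integral_lborel_mult_unit)
  also have "\<dots> = (\<integral>\<^sup>+z. \<integral>\<^sup>+t. G (cis t * z) * indicator {0..2 * pi} t \<partial>lborel \<partial>lborel)"
    by (rule lborel_pair.Fubini') simp
  also have "\<dots> = (\<integral>\<^sup>+z\<in>ball 0 1. ennreal (w z * (2 * pi * (\<Sum>n<N. (cmod (p n))\<^sup>2 * cmod z ^ (2 * n)))) \<partial>lborel)"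
  proof (rule nn_integral_cong)
    fix z :: complex
    have [measurable]: "(\<lambda>t. P (cis t * z)) \<in> borel_measurable borel"
      unfolding P_def cis_conv_exp by (auto intro!: borel_measurable_continuous_onI continuous_intros)
    have "(\<integral>\<^sup>+t. G (cis t * z) * indicator {0..2 * pi} t \<partial>lborel)
        = (\<integral>\<^sup>+t. ennreal (w z) * indicator (ball 0 1) z * (ennreal (P (cis t * z)) * indicator {0..2 * pi} t) \<partial>lborel)"
      unfolding G_rot by (simp only: mult_ac)
    also have "\<dots> = ennreal (w z) * indicator (ball 0 1) z
        * ennreal (2 * pi * (\<Sum>n<N. (cmod (p n))\<^sup>2 * cmod z ^ (2 * n)))"
      by (simp add: nn_integral_cmult circle)
    finally show "(\<integral>\<^sup>+t. G (cis t * z) * indicator {0..2 * pi} t \<partial>lborel)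
        = ennreal (w z * (2 * pi * (\<Sum>n<N. (cmod (p n))\<^sup>2 * cmod z ^ (2 * n)))) * indicator (ball 0 1) z"
      by (auto simp: indicator_def ennreal_mult w_nonneg sum_nonneg)
  qed
  also have "\<dots> = (\<integral>\<^sup>+z. (\<Sum>n<N. ennreal (2 * pi * (cmod (p n))\<^sup>2 * (real a)\<^sup>2) *
      (ennreal (cmod z ^ (2 * (a + n)) * (1 - (cmod z)\<^sup>2)) * indicator (ball 0 1) z)) \<partial>lborel)"
  proof (rule nn_integral_cong)
    fix z :: complex
    show "ennreal (w z * (2 * pi * (\<Sum>n<N. (cmod (p n))\<^sup>2 * cmod z ^ (2 * n)))) * indicator (ball 0 1) z
       = (\<Sum>n<N. ennreal (2 * pi * (cmod (p n))\<^sup>2 * (real a)\<^sup>2) *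
      (ennreal (cmod z ^ (2 * (a + n)) * (1 - (cmod z)\<^sup>2)) * indicator (ball 0 1) z))"
    proof (cases "z \<in> ball 0 1")
      case True
      then have "(cmod z)\<^sup>2 \<le> 1"
        by (simp add: abs_square_le_1)
      then show ?thesis
        using True
        by (simp add: ennreal_mult[symmetric] sum_ennreal w_def sum_distrib_left)
          (intro arg_cong[of _ _ ennreal] sum.cong, auto simp: distrib_left power_add mult_ac)
    qed simp
  qed
  also have "\<dots> = (\<Sum>n<N. ennreal (2 * pi * (cmod (p n))\<^sup>2 * (real a)\<^sup>2) *
      ennreal (pi / ((real (a + n) + 1) * (real (a + n) + 2))))"
    by (simp add: nn_integral_sum nn_integral_cmult nn_integral_disc_moment del: distrib_left_numeral)
  also have "\<dots> \<le> (\<Sum>n<N. ennreal (2 * pi * (pi * (cmod (p n))\<^sup>2)))"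
  proof (rule sum_mono)
    fix n
    have "(real a)\<^sup>2 \<le> (real (a + n) + 1) * (real (a + n) + 2)"
      unfolding power2_eq_square by (intro mult_mono) auto
    then have "(real a)\<^sup>2 / ((real (a + n) + 1) * (real (a + n) + 2)) \<le> 1"
      by (simp add: divide_le_eq_1 add_pos_pos)
    then have "2 * pi * pi * (cmod (p n))\<^sup>2 * ((real a)\<^sup>2 / ((real (a + n) + 1) * (real (a + n) + 2)))
        \<le> 2 * pi * pi * (cmod (p n))\<^sup>2 * 1"
      by (intro mult_left_mono) auto
    then show "ennreal (2 * pi * (cmod (p n))\<^sup>2 * (real a)\<^sup>2) *
      ennreal (pi / ((real (a + n) + 1) * (real (a + n) + 2))) \<le> ennreal (2 * pi * (pi * (cmod (p n))\<^sup>2))"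
      by (simp add: ennreal_mult[symmetric] mult_ac)
  qed
  also have "\<dots> = ennreal (2 * pi) * ennreal (pi * (\<Sum>n<N. (cmod (p n))\<^sup>2))"
    by (simp add: sum_ennreal ennreal_mult[symmetric] sum_distrib_left sum_nonneg)
  finally have "(\<integral>\<^sup>+z. G z \<partial>lborel) \<le> ennreal (pi * (\<Sum>n<N. (cmod (p n))\<^sup>2))"
    by (simp add: ennreal_mult_le_mult_iff)
  moreover have "G = (\<lambda>z. ennreal ((real a * cmod (z ^ a * (\<Sum>n<N. p n * z ^ n)))\<^sup>2
      * (1 - (cmod z)\<^sup>2)) * indicator (ball 0 1) z)"
    by (simp add: G_def w_def P_def norm_mult norm_power power_mult_distrib power_mult fun_eq_iff
        power_even_eq mult_ac)
  ultimately show ?thesis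
    by simp
qed

subsection \<open>Hilbert's inequality\<close>

text \<open>The case \<open>j = 0\<close> fits the same formula: \<open>t - pi\<close> has mean
  zero, and the right-hand side is \<open>0\<close> by the convention for division by zero.\<close>

lemma has_integral_sawtooth_cis:
  "((\<lambda>t. of_real (t - pi) * cis (of_int j * t)) has_integral 2 * pi / (\<i> * of_int j)) {0..2 * pi}"
proof (cases "j = 0")
  case True
  have "((\<lambda>t. t - pi) has_integral (((2 * pi) ^ 2 / 2 - pi * (2 * pi)) - (0 ^ 2 / 2 - pi * 0))) {0..2 * pi}"
    by (rule fundamental_theorem_of_calculus)
      (auto intro!: derivative_eq_intros simp: has_real_derivative_iff_has_vector_derivative[symmetric])
  then have "((\<lambda>t. complex_of_real (t - pi)) has_integral of_real 0) {0..2 * pi}"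
    by (intro has_integral_of_real) (simp add: power2_eq_square)
  then show ?thesis
    using True by simp
next
  case False
  \<comment> \<open>Integration by parts, with \<open>1 / j^2 = - 1 / (\<i> * j)^2\<close> in the
    second term. That term agrees at both endpoints, so only the jump \<open>2 * pi\<close> of the
    sawtooth survives.\<close>
  define F where "F = (\<lambda>z. (z - of_real pi) * exp (\<i> * (of_int j * z)) / (\<i> * of_int j)
    + exp (\<i> * (of_int j * z)) / (of_int j)\<^sup>2)"
  have F: "(F has_field_derivative (z - of_real pi) * exp (\<i> * (of_int j * z))) (at z)" for z
    unfolding F_def using False
    by (auto intro!: derivative_eq_intros simp: power2_eq_square) (simp add: field_simps)
  have "((\<lambda>t. of_real (t - pi) * cis (of_int j * t)) has_integral
      F (of_real (2 * pi)) - F (of_real 0)) {0..2 * pi}"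
  proof (rule fundamental_theorem_of_calculus)
    show "((\<lambda>t. F (of_real t)) has_vector_derivative of_real (t - pi) * cis (of_int j * t))
        (at t within {0..2 * pi})" for t
      using has_vector_derivative_real_field[OF F[of "of_real t"], of "{0..2 * pi}"]
      by (simp add: cis_conv_exp)
  qed simp
  moreover have "exp (\<i> * (of_int j * of_real (2 * pi))) = 1"
    using cis_multiple_2pi[of "of_int j"] by (simp add: cis_conv_exp mult_ac)
  then have "F (of_real (2 * pi)) - F (of_real 0) = 2 * pi / (\<i> * of_int j)"
    using False by (simp add: F_def field_simps)
  ultimately show ?thesis
    by simp
qed

text \<open>The diagonal terms vanish because \<open>1 / 0 = 0\<close>. The kernel
  \<open>1 / (k - m)\<close> is a Fourier coefficient of the bounded function \<open>t - pi\<close> on \<open>[0, 2 pi]\<close>.\<close>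

lemma Hilbert_bilinear_bound:
  fixes x y :: "nat \<Rightarrow> complex"
  shows "cmod (\<Sum>k<K. \<Sum>m<K. y k * x m / of_int (int k - int m))
    \<le> pi / 2 * ((\<Sum>k<K. (cmod (y k))\<^sup>2) + (\<Sum>m<K. (cmod (x m))\<^sup>2))"
proof -
  define Y where "Y = (\<lambda>t. \<Sum>k<K. y k * cis (real k * t))"
  define X where "X = (\<lambda>t. \<Sum>m<K. x m * cis (- real m * t))"
  define S where "S = (\<Sum>k<K. \<Sum>m<K. y k * x m / of_int (int k - int m))"
  define T where "T = (\<Sum>k<K. (cmod (y k))\<^sup>2) + (\<Sum>m<K. (cmod (x m))\<^sup>2)"
  have "((\<lambda>t. \<Sum>k<K. \<Sum>m<K. y k * x m * (of_real (t - pi) * cis (of_int (int k - int m) * t)))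
      has_integral (\<Sum>k<K. \<Sum>m<K. y k * x m * (2 * pi / (\<i> * of_int (int k - int m))))) {0..2 * pi}"
    by (intro has_integral_sum has_integral_mult_right has_integral_sawtooth_cis) auto
  moreover have "(\<Sum>k<K. \<Sum>m<K. y k * x m * (2 * pi / (\<i> * of_int (int k - int m)))) = 2 * pi / \<i> * S"
  proof -
    have "a * (2 * pi / (\<i> * w)) = 2 * pi / \<i> * (a / w)" for a w :: complex
      by (simp add: divide_inverse mult_ac)
    then show ?thesis
      unfolding S_def sum_distrib_left by (simp only:)
  qed
  moreover have "(\<Sum>k<K. \<Sum>m<K. y k * x m * (of_real (t - pi) * cis (of_int (int k - int m) * t)))
      = of_real (t - pi) * (Y t * X t)" for t
  proof -
    have "cis (real k * t) * cis (- real m * t) = cis (of_int (int k - int m) * t)" for k m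
      by (simp add: cis_mult algebra_simps)
    then have "(y k * cis (real k * t)) * (x m * cis (- real m * t))
        = y k * x m * cis (of_int (int k - int m) * t)" for k m
      by (metis mult.assoc mult.left_commute)
    then have "Y t * X t = (\<Sum>k<K. \<Sum>m<K. y k * x m * cis (of_int (int k - int m) * t))"
      unfolding Y_def X_def sum_product by (simp only:)
    then show ?thesis
      by (simp add: sum_distrib_left mult_ac del: of_int_diff)
  qed
  ultimately have I: "((\<lambda>t. of_real (t - pi) * (Y t * X t)) has_integral 2 * pi / \<i> * S) {0..2 * pi}"
    by simp
  have "((\<lambda>t. (cmod (Y t))\<^sup>2) has_integral 2 * pi * (\<Sum>k<K. (cmod (y k))\<^sup>2)) {0..2 * pi}"
    unfolding Y_def by (rule has_integral_trig_poly_norm)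
  moreover have "((\<lambda>t. (cmod (X t))\<^sup>2) has_integral 2 * pi * (\<Sum>m<K. (cmod (x m))\<^sup>2)) {0..2 * pi}"
  proof -
    have "cmod (X t) = cmod (\<Sum>m<K. cnj (x m) * cis (real m * t))" for t
      unfolding X_def by (subst complex_mod_cnj[symmetric]) (simp add: cis_cnj cnj_sum)
    then show ?thesis
      using has_integral_trig_poly_norm[of "\<lambda>m. cnj (x m)" K] by simp
  qed
  ultimately have J: "((\<lambda>t. pi / 2 * ((cmod (Y t))\<^sup>2 + (cmod (X t))\<^sup>2)) has_integral
      pi / 2 * (2 * pi * (\<Sum>k<K. (cmod (y k))\<^sup>2) + 2 * pi * (\<Sum>m<K. (cmod (x m))\<^sup>2))) {0..2 * pi}"
    by (intro has_integral_mult_right has_integral_add)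
  have "norm (of_real (t - pi) * (Y t * X t)) \<le> pi / 2 * ((cmod (Y t))\<^sup>2 + (cmod (X t))\<^sup>2)"
    if "t \<in> {0..2 * pi}" for t
  proof -
    have "\<bar>t - pi\<bar> \<le> pi"
      using that
      by auto
    moreover have "cmod (Y t) * cmod (X t) \<le> ((cmod (Y t))\<^sup>2 + (cmod (X t))\<^sup>2) / 2"
      using sum_squares_bound[of "cmod (Y t)" "cmod (X t)"] by simp
    ultimately have "\<bar>t - pi\<bar> * (cmod (Y t) * cmod (X t)) \<le> pi * (((cmod (Y t))\<^sup>2 + (cmod (X t))\<^sup>2) / 2)"
      by (intro mult_mono) auto
    then show ?thesis
      by (simp add: norm_mult del: of_real_diff)
  qed
  then have "norm (2 * pi / \<i> * S)
      \<le> pi / 2 * (2 * pi * (\<Sum>k<K. (cmod (y k))\<^sup>2) + 2 * pi * (\<Sum>m<K. (cmod (x m))\<^sup>2))"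
    using has_integral_norm_bound_integral_component[OF I J, of 1] by simp
  then have "2 * pi * cmod S \<le> 2 * pi * (pi / 2 * T)"
    by (simp add: norm_mult norm_divide T_def algebra_simps)
  then show ?thesis
    unfolding S_def T_def by (rule mult_left_le_imp_le) simp
qed

text \<open>Duality: the bilinear bound is tested with \<open>y\<close> the conjugate of the image
  of \<open>x\<close>, divided by \<open>pi\<close>. Since that bound is a sum of squares rather
  than a product, the scaling matters; \<open>1 / pi\<close> is the optimal one and gives
  \<open>S / pi \<le> S / (2 * pi) + pi * T / 2\<close>.\<close>

lemma Hilbert_inequality:
  fixes x :: "nat \<Rightarrow> complex"
  shows "(\<Sum>k<K. (cmod (\<Sum>m<K. x m / of_int (int k - int m)))\<^sup>2) \<le> pi\<^sup>2 * (\<Sum>m<K. (cmod (x m))\<^sup>2)"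
proof -
  define a where "a = (\<lambda>k. \<Sum>m<K. x m / of_int (int k - int m))"
  define S where "S = (\<Sum>k<K. (cmod (a k))\<^sup>2)"
  define T where "T = (\<Sum>m<K. (cmod (x m))\<^sup>2)"
  have "(\<Sum>k<K. \<Sum>m<K. (cnj (a k) / of_real pi) * x m / of_int (int k - int m)) = of_real (S / pi)"
  proof -
    have "(\<Sum>m<K. (cnj (a k) / of_real pi) * x m / of_int (int k - int m))
        = (cnj (a k) / of_real pi) * a k" for k
    proof -
      have "(\<Sum>m<K. (cnj (a k) / of_real pi) * x m / of_int (int k - int m))
          = (cnj (a k) / of_real pi) * (\<Sum>m<K. x m / of_int (int k - int m))"
        by (simp only: sum_distrib_left times_divide_eq_right)
      then show ?thesis
        by (simp add: a_def)
    qed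
    then show ?thesis
      by (simp add: S_def sum_divide_distrib complex_norm_square[symmetric] mult.commute[of "cnj _"]
          del: of_int_diff)
  qed
  moreover have "(\<Sum>k<K. (cmod (cnj (a k) / of_real pi))\<^sup>2) = S / pi\<^sup>2"
    by (simp add: S_def norm_divide power_divide sum_divide_distrib)
  moreover have "0 \<le> S"
    unfolding S_def by (intro sum_nonneg) auto
  ultimately have "S / pi \<le> pi / 2 * (S / pi\<^sup>2 + T)"
    using Hilbert_bilinear_bound[where K = K and x = x and y = "\<lambda>k. cnj (a k) / of_real pi"]
    by (simp add: T_def del: of_real_divide of_int_diff)
  then have "S \<le> pi\<^sup>2 * T"
    by (simp add: field_simps power2_eq_square)
  then show ?thesis
    by (simp add: S_def T_def a_def)
qed

subsection \<open>Complex Hilbert spaces and their operators\<close>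

instance complex_hilbert_space \<subseteq> banach ..

lemma bounded_bilinear_scaleC:
  "bounded_bilinear (\<lambda>c (x :: 'a::complex_normed_vector). c *\<^sub>C x)"
proof
  show "(r *\<^sub>R c) *\<^sub>C x = r *\<^sub>R (c *\<^sub>C x)" "c *\<^sub>C (r *\<^sub>R x) = r *\<^sub>R (c *\<^sub>C x)"
    for r c and x :: 'a
    by (simp_all add: scaleR_scaleC scaleC_scaleC scaleR_conv_of_real mult.commute)
  show "\<exists>K. \<forall>c (x :: 'a). norm (c *\<^sub>C x) \<le> norm c * norm x * K"
    by (rule exI[of _ 1]) (simp add: norm_scaleC)
qed (simp_all add: scaleC_add_left scaleC_add_right)

lemmas scaleC_sum_right = bounded_bilinear.sum_right[OF bounded_bilinear_scaleC]
lemmas scaleC_sum_left = bounded_bilinear.sum_left[OF bounded_bilinear_scaleC]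

lemma cinner_add_right: "cinner x (y + z) = cinner x y + cinner x z"
  by (metis cinner_add_left cinner_commute complex_cnj_add)

lemma cinner_scaleC_right: "cinner x (a *\<^sub>C y) = cnj a * cinner x y"
  by (metis cinner_scaleC_left cinner_commute complex_cnj_mult)

lemma cinner_zero_left [simp]: "cinner 0 y = 0"
  using cinner_scaleC_left[of 0 0 y] by simp

lemma cinner_zero_right [simp]: "cinner y 0 = 0"
  using cinner_scaleC_right[of y 0 0] by simp

lemma cinner_sum_left: "cinner (\<Sum>i\<in>A. f i) y = (\<Sum>i\<in>A. cinner (f i) y)"
  by (induction A rule: infinite_finite_induct) (simp_all add: cinner_add_left)

lemma cinner_sum_right: "cinner y (\<Sum>i\<in>A. f i) = (\<Sum>i\<in>A. cinner y (f i))"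
  by (induction A rule: infinite_finite_induct) (simp_all add: cinner_add_right)

lemma norm_add_orthogonal:
  assumes "cinner x y = 0"
  shows "(norm (x + y))\<^sup>2 = (norm x)\<^sup>2 + (norm y)\<^sup>2"
proof -
  have "cinner y x = 0"
    using assms by (subst cinner_commute) simp
  then have "complex_of_real ((norm (x + y))\<^sup>2) = of_real ((norm x)\<^sup>2 + (norm y)\<^sup>2)"
    using assms unfolding cinner_self[symmetric] of_real_add
    by (simp add: cinner_add_left cinner_add_right)
  then show ?thesis
    by (simp only: of_real_eq_iff)
qed

section \<open>Orthonormal families\<close>

definition orthonormal_on :: "'i set \<Rightarrow> ('i \<Rightarrow> 'a::complex_hilbert_space) \<Rightarrow> bool"
  where "orthonormal_on I e \<longleftrightarrow> (\<forall>i\<in>I. \<forall>j\<in>I. cinner (e i) (e j) = (if i = j then 1 else 0))"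

lemma orthonormal_on_subset: "orthonormal_on J e \<Longrightarrow> I \<subseteq> J \<Longrightarrow> orthonormal_on I e"
  unfolding orthonormal_on_def by blast
lemma cinner_orthonormal_sum:
  assumes "orthonormal_on I e" "finite I" "k \<in> I"
  shows "cinner (\<Sum>i\<in>I. a i *\<^sub>C e i) (e k) = a k"
proof -
  have "cinner (\<Sum>i\<in>I. a i *\<^sub>C e i) (e k) = (\<Sum>i\<in>I. if k = i then a i else 0)"
    unfolding cinner_sum_left using assms
    by (intro sum.cong) (auto simp: orthonormal_on_def cinner_scaleC_left)
  then show ?thesis
    using assms by simp
qed

lemma norm_orthonormal_sum:
  assumes "orthonormal_on I e" "finite I"
  shows "(norm (\<Sum>i\<in>I. a i *\<^sub>C e i))\<^sup>2 = (\<Sum>i\<in>I. (cmod (a i))\<^sup>2)"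
proof -
  define x where "x = (\<Sum>i\<in>I. a i *\<^sub>C e i)"
  have "complex_of_real ((norm x)\<^sup>2) = (\<Sum>i\<in>I. cnj (a i) * cinner x (e i))"
    unfolding cinner_self[symmetric] by (subst (2) x_def) (simp add: cinner_sum_right cinner_scaleC_right)
  also have "\<dots> = (\<Sum>i\<in>I. cnj (a i) * a i)"
    using cinner_orthonormal_sum[OF assms, of _ a] by (simp add: x_def)
  also have "\<dots> = of_real (\<Sum>i\<in>I. (cmod (a i))\<^sup>2)"
    by (simp add: complex_norm_square[symmetric] mult.commute)
  finally show ?thesis
    by (simp only: of_real_eq_iff x_def)
qed

lemma cinner_diff_orthonormal_projection:
  assumes "orthonormal_on I e" "finite I" "k \<in> I"
  shows "cinner (x - (\<Sum>i\<in>I. cinner x (e i) *\<^sub>C e i)) (e k) = 0"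
  using cinner_orthonormal_sum[OF assms, of "\<lambda>i. cinner x (e i)"]
    cinner_add_left[of "x - (\<Sum>i\<in>I. cinner x (e i) *\<^sub>C e i)" "\<Sum>i\<in>I. cinner x (e i) *\<^sub>C e i" "e k"]
  by simp

lemma Bessel_inequality:
  assumes "orthonormal_on I e" "finite I"
  shows "(\<Sum>i\<in>I. (cmod (cinner x (e i)))\<^sup>2) \<le> (norm x)\<^sup>2"
proof -
  define p where "p = (\<Sum>i\<in>I. cinner x (e i) *\<^sub>C e i)"
  have "cinner (x - p) p = (\<Sum>i\<in>I. cnj (cinner x (e i)) * cinner (x - p) (e i))"
    by (subst (2) p_def) (simp add: cinner_sum_right cinner_scaleC_right)
  also have "\<dots> = 0"
    using cinner_diff_orthonormal_projection[OF assms, of _ x] by (simp add: p_def)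
  finally have "(norm (x - p + p))\<^sup>2 = (norm (x - p))\<^sup>2 + (norm p)\<^sup>2"
    by (rule norm_add_orthogonal)
  moreover have "(norm p)\<^sup>2 = (\<Sum>i\<in>I. (cmod (cinner x (e i)))\<^sup>2)"
    unfolding p_def by (rule norm_orthonormal_sum[OF assms])
  ultimately show ?thesis
    by simp
qed

text \<open>Cauchy-Schwarz as Bessel's inequality for a one-element family, the normalised
  \<open>y\<close> indexed by the unit type.\<close>

lemma norm_cinner_le: "cmod (cinner x y) \<le> norm x * norm y"
proof (cases "y = 0")
  case False
  define u where "u = complex_of_real (inverse (norm y)) *\<^sub>C y"
  have "norm u = 1"
    using False by (simp add: u_def norm_scaleC norm_inverse)
  then have "cinner u u = 1"
    by (simp add: cinner_self)
  then have "(cmod (cinner x u))\<^sup>2 \<le> (norm x)\<^sup>2"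
    using Bessel_inequality[of "{()}" "\<lambda>_. u" x] by (simp add: orthonormal_on_def)
  then have "cmod (cinner x u) \<le> norm x"
    by (rule power2_le_imp_le) simp
  then show ?thesis
    using False by (simp add: u_def cinner_scaleC_right norm_mult norm_divide field_simps)
qed simp

lemma bounded_bilinear_cinner:
  "bounded_bilinear (\<lambda>x y :: 'a::complex_hilbert_space. cinner x y)"
proof
  show "cinner (r *\<^sub>R x) y = r *\<^sub>R cinner x y" "cinner x (r *\<^sub>R y) = r *\<^sub>R cinner x y"
    for r and x y :: 'a
    by (simp_all add: scaleR_scaleC cinner_scaleC_left cinner_scaleC_right scaleR_conv_of_real)
  show "\<exists>K. \<forall>x y :: 'a. norm (cinner x y) \<le> norm x * norm y * K"
    by (rule exI[of _ 1]) (simp add: norm_cinner_le)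
qed (simp_all add: cinner_add_left cinner_add_right)

text \<open>Gram-Schmidt as a dependent choice: the span of the vectors chosen so far is never the
  whole space, and the residual of a vector outside it can be normalised. Completeness of the
  sequence is not claimed. On the orthogonal complement the symbol will act as zero, and Bessel's
  inequality takes the place of Parseval's identity.\<close>

lemma exists_orthonormal_sequence:
  assumes "\<not> (\<exists>B :: 'a::complex_hilbert_space set. finite B \<and> cspan B = UNIV)"
  obtains e :: "nat \<Rightarrow> 'a::complex_hilbert_space" where "orthonormal_on UNIV e"
proof -
  define P where "P = (\<lambda>(e :: nat \<Rightarrow> 'a) n u. norm u = 1 \<and> (\<forall>i<n. cinner u (e i) = 0))"
  have "\<exists>e. \<forall>n. P e n (e n)"
  proof (rule dependent_wellorder_choice)
    show "P f n r = P g n r" if "\<And>m. m < n \<Longrightarrow> f m = g m" for r f g n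
      using that by (simp add: P_def)
    fix n and e :: "nat \<Rightarrow> 'a"
    assume e: "\<And>m. m < n \<Longrightarrow> P e m (e m)"
    have "cinner (e i) (e j) = (if i = j then 1 else 0)" if "i < n" "j < n" for i j
      using that e[of i] e[of j] cinner_commute[of "e i" "e j"]
      by (cases i j rule: linorder_cases) (auto simp: P_def cinner_self)
    then have orth: "orthonormal_on {..<n} e"
      by (simp add: orthonormal_on_def)
    have "cspan (e ` {..<n}) \<noteq> UNIV"
      using assms by blast
    then obtain x where x: "x \<notin> cspan (e ` {..<n})"
      by blast
    define p where "p = (\<Sum>i<n. cinner x (e i) *\<^sub>C e i)"
    have "p \<in> cspan (e ` {..<n})"
      unfolding p_def by (intro complex_vector.span_sum complex_vector.span_scale complex_vector.span_base) auto
    with x have "x - p \<noteq> 0"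
      by auto
    moreover have "cinner (x - p) (e i) = 0" if "i < n" for i
      unfolding p_def by (rule cinner_diff_orthonormal_projection[OF orth]) (use that in auto)
    ultimately have "P e n (complex_of_real (inverse (norm (x - p))) *\<^sub>C (x - p))"
      by (simp add: P_def norm_scaleC norm_inverse cinner_scaleC_left)
    then show "\<exists>u. P e n u" ..
  qed
  then obtain e where e: "\<And>n. P e n (e n)"
    by blast
  have "cinner (e i) (e j) = (if i = j then 1 else 0)" for i j
    using e[of i] e[of j] cinner_commute[of "e i" "e j"]
    by (cases i j rule: linorder_cases) (auto simp: P_def cinner_self)
  then show thesis
    by (intro that[of e]) (simp add: orthonormal_on_def)
qed

section \<open>Bounded complex-linear operators: completeness and rank-one operators\<close>

lemma norm_cblinop_apply_le: "norm (cblinop_apply T x) \<le> norm T * norm x"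
  by transfer (rule norm_blinfun)

lemma norm_cblinop_le:
  assumes "0 \<le> B" "\<And>x. norm (cblinop_apply T x) \<le> B * norm x"
  shows "norm T \<le> B"
  using assms by transfer (rule norm_blinfun_bound)

lemma bounded_bilinear_cblinop_apply:
  "bounded_bilinear (\<lambda>T (x :: 'a::complex_normed_vector). cblinop_apply T x)"
proof
  show "cblinop_apply T (x + y) = cblinop_apply T x + cblinop_apply T y"
    "cblinop_apply T (r *\<^sub>R x) = r *\<^sub>R cblinop_apply T x" for T r and x y :: 'a
    by (transfer; simp add: blinfun.add_right blinfun.scaleR_right)+
  show "\<exists>K. \<forall>T (x :: 'a). norm (cblinop_apply T x) \<le> norm T * norm x * K"
    by (rule exI[of _ 1]) (simp add: norm_cblinop_apply_le)
qed (simp_all add: cblinop_apply_add cblinop_apply_scaleR)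

lemmas cblinop_apply_sum_left = bounded_bilinear.sum_left[OF bounded_bilinear_cblinop_apply]

text \<open>Complex homogeneity survives pointwise limits, so these operators form a closed subspace
  of the complete space of real-linear ones. Completeness is what turns norm estimates on
  coefficients into convergence of operator-valued power series.\<close>

instance cblinop :: (complex_hilbert_space) banach
proof
  fix X :: "nat \<Rightarrow> 'a cblinop"
  assume X: "Cauchy X"
  have dist_eq: "dist (blinfun_of_cblinop S) (blinfun_of_cblinop T) = dist S T" for S T :: "'a cblinop"
    by (simp add: dist_norm norm_cblinop.rep_eq minus_cblinop.rep_eq)
  have "Cauchy (\<lambda>n. blinfun_of_cblinop (X n))"
    using X by (simp add: Cauchy_def dist_eq)
  then obtain L where L: "(\<lambda>n. blinfun_of_cblinop (X n)) \<longlonglongrightarrow> L"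
    by (auto simp: Cauchy_convergent_iff convergent_def)
  have pt: "(\<lambda>n. blinfun_apply (blinfun_of_cblinop (X n)) x) \<longlonglongrightarrow> blinfun_apply L x" for x
    using L by (intro tendsto_intros)
  have "blinfun_apply L (c *\<^sub>C x) = c *\<^sub>C blinfun_apply L x" for c x
  proof (rule LIMSEQ_unique)
    show "(\<lambda>n. blinfun_apply (blinfun_of_cblinop (X n)) (c *\<^sub>C x)) \<longlonglongrightarrow> blinfun_apply L (c *\<^sub>C x)"
      by (rule pt)
    have "(\<lambda>n. c *\<^sub>C blinfun_apply (blinfun_of_cblinop (X n)) x) \<longlonglongrightarrow> c *\<^sub>C blinfun_apply L x"
      by (rule bounded_linear.tendsto[OF bounded_linear_scaleC pt])
    then show "(\<lambda>n. blinfun_apply (blinfun_of_cblinop (X n)) (c *\<^sub>C x)) \<longlonglongrightarrow> c *\<^sub>C blinfun_apply L x"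
      using blinfun_of_cblinop[of "X _"] by simp
  qed
  then have "blinfun_of_cblinop (Cblinop L) = L"
    by (simp add: Cblinop_inverse)
  then have "dist (X n) (Cblinop L) = dist (blinfun_of_cblinop (X n)) L" for n
    using dist_eq[of "X n" "Cblinop L"] by simp
  then have "X \<longlonglongrightarrow> Cblinop L"
    using L by (simp add: lim_sequentially)
  then show "convergent X"
    by (auto simp: convergent_def)
qed

lemma bounded_linear_cinner_scaleC: "bounded_linear (\<lambda>x. cinner x v *\<^sub>C u)"
  by (rule bounded_linear_compose[OF
        bounded_bilinear.bounded_linear_left[OF bounded_bilinear_scaleC]
        bounded_bilinear.bounded_linear_left[OF bounded_bilinear_cinner]])

lift_definition rank_one :: "'a::complex_hilbert_space \<Rightarrow> 'a \<Rightarrow> 'a cblinop"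
  is "\<lambda>u v. Blinfun (\<lambda>x. cinner x v *\<^sub>C u)"
  by (simp add: bounded_linear_Blinfun_apply bounded_linear_cinner_scaleC cinner_scaleC_left
      scaleC_scaleC)

lemma rank_one_apply: "cblinop_apply (rank_one u v) x = cinner x v *\<^sub>C u"
  by transfer (simp add: bounded_linear_Blinfun_apply bounded_linear_cinner_scaleC)

lemma norm_rank_one_le: "norm (rank_one u v) \<le> norm u * norm v"
proof (rule norm_cblinop_le)
  show "norm (cblinop_apply (rank_one u v) x) \<le> norm u * norm v * norm x" for x
    using mult_right_mono[OF norm_cinner_le[of x v] norm_ge_zero[of u]]
    by (simp add: rank_one_apply norm_scaleC mult_ac)
qed simp

section \<open>Termwise differentiation of vector-valued power series\<close>

lemma cderiv_eqI:
  assumes "(f has_derivative (\<lambda>h. h *\<^sub>C d)) (at z)"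
  shows "cderiv f z = d"
  unfolding cderiv_def
proof (rule some_equality[where P = "\<lambda>d. (f has_derivative (\<lambda>h. h *\<^sub>C d)) (at z)"])
  fix d'
  assume "(f has_derivative (\<lambda>h. h *\<^sub>C d')) (at z)"
  then have "(\<lambda>h. h *\<^sub>C d') = (\<lambda>h. h *\<^sub>C d)"
    by (rule has_derivative_unique) (rule assms)
  from fun_cong[OF this, of 1] show "d' = d"
    by simp
qed (rule assms)

text \<open>The hypothesis gives only pointwise convergence. Convergence at a radius
  \<open>\<sigma>\<close> with \<open>|z| < \<sigma> < R\<close> bounds the coefficients by
  \<open>M / \<sigma> ^ n\<close>; on a smaller disc of radius \<open>\<rho>\<close>, still
  containing \<open>z\<close>, the derived series is then dominated by \<open>m\<close> and
  converges uniformly, which permits termwise differentiation.\<close>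

lemma has_power_series_D_op:
  fixes f :: "complex \<Rightarrow> 'b::{complex_normed_vector, banach}"
  assumes f: "has_power_series_on_disc f c R" and z: "z \<in> ball 0 R"
  shows "(\<lambda>n. z ^ n *\<^sub>C of_nat (Suc n) *\<^sub>C c n) sums D_op f z"
proof -
  have "cmod z < R"
    using z by simp
  then obtain \<rho> where "cmod z < \<rho>" "\<rho> < R"
    using dense by blast
  then obtain \<sigma> where rs: "cmod z < \<rho>" "\<rho> < \<sigma>" "\<sigma> < R"
    using dense by blast
  have "0 < \<rho>"
    using rs(1) norm_ge_zero[of z] by linarith
  with rs(2) have pos: "0 < \<rho>" "0 < \<sigma>"
    by linarith+
  have "(\<lambda>n. of_real \<sigma> ^ n *\<^sub>C c n) sums f (of_real \<sigma>)"
    using f rs pos by (auto simp: has_power_series_on_disc_def)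
  then have "(\<lambda>n. of_real \<sigma> ^ n *\<^sub>C c n) \<longlonglongrightarrow> 0"
    by (intro summable_LIMSEQ_zero sums_summable)
  then have "Bseq (\<lambda>n. of_real \<sigma> ^ n *\<^sub>C c n)"
    by (intro convergent_imp_Bseq convergentI)
  then obtain M where M: "\<And>n. norm (of_real \<sigma> ^ n *\<^sub>C c n) \<le> M"
    using BseqE by blast
  have norm_c: "norm (c n) \<le> M / \<sigma> ^ n" for n
    using M[of n] pos by (simp add: norm_scaleC norm_power pos_le_divide_eq mult.commute)
  define d where "d = (\<lambda>n x. (of_nat n * x ^ (n - 1)) *\<^sub>C c n)"
  define D where "D = (\<lambda>x. suminf (\<lambda>n. d n x))"
  define m where "m = (\<lambda>n. real n * \<rho> ^ (n - 1) * (M / \<sigma> ^ n))"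
  have d_le: "norm (d n x) \<le> m n" if "x \<in> ball 0 \<rho>" for n x
  proof -
    have "cmod x ^ (n - 1) \<le> \<rho> ^ (n - 1)"
      using that by (intro power_mono) auto
    then show ?thesis
      unfolding d_def m_def norm_scaleC norm_mult norm_power norm_of_nat
      using norm_c[of n] pos by (intro mult_mono) auto
  qed
  have "summable m"
  proof -
    have "summable (\<lambda>n. of_nat (Suc n) * (\<rho> / \<sigma>) ^ n)"
      using pos rs by (intro sums_summable[OF geometric_deriv_sums]) simp
    then have "summable (\<lambda>n. M / \<sigma> * (of_nat (Suc n) * (\<rho> / \<sigma>) ^ n))"
      by (rule summable_mult)
    also have "(\<lambda>n. M / \<sigma> * (of_nat (Suc n) * (\<rho> / \<sigma>) ^ n)) = (\<lambda>n. m (Suc n))"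
      by (simp add: m_def fun_eq_iff power_divide)
    finally show ?thesis
      by (simp add: summable_Suc_iff)
  qed
  have unif: "uniform_limit (ball 0 \<rho>) (\<lambda>n x. \<Sum>i<n. d i x) D sequentially"
    unfolding D_def using d_le \<open>summable m\<close> by (rule Weierstrass_m_test)
  have sums: "(\<lambda>n. x ^ n *\<^sub>C c n) sums f x" if "x \<in> ball 0 \<rho>" for x
    using f that rs by (auto simp: has_power_series_on_disc_def)
  have "\<exists>g. \<forall>x\<in>ball 0 \<rho>. (\<lambda>n. x ^ n *\<^sub>C c n) sums g x
      \<and> (g has_derivative (\<lambda>h. h *\<^sub>C D x)) (at x within ball 0 \<rho>)"
  proof (rule has_derivative_series[where f' = "\<lambda>n x h. h *\<^sub>C d n x" and x = z and l = "f z"])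
    show "((\<lambda>x. x ^ n *\<^sub>C c n) has_derivative (\<lambda>h. h *\<^sub>C d n x)) (at x within ball 0 \<rho>)" for n x
    proof -
      have "((\<lambda>x. x ^ n) has_derivative (\<lambda>h. (of_nat n * x ^ (n - 1)) * h)) (at x within ball 0 \<rho>)"
        using DERIV_power[OF DERIV_ident, of n x "ball 0 \<rho>"] by (simp add: has_field_derivative_def)
      from bounded_linear.has_derivative[OF
          bounded_bilinear.bounded_linear_left[OF bounded_bilinear_scaleC] this, of "c n"]
      show ?thesis
        by (simp only: d_def scaleC_scaleC mult.commute mult.left_commute)
    qed
    show "z \<in> ball 0 \<rho>"
      using rs by simp
    then show "(\<lambda>n. z ^ n *\<^sub>C c n) sums f z"
      by (rule sums)
    fix \<epsilon> :: real
    assume "\<epsilon> > 0"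
    then have "\<forall>\<^sub>F n in sequentially. \<forall>x\<in>ball 0 \<rho>. dist (\<Sum>i<n. d i x) (D x) < \<epsilon>"
      using unif by (simp add: uniform_limit_iff)
    then show "\<forall>\<^sub>F n in sequentially. \<forall>x\<in>ball 0 \<rho>. \<forall>h.
        norm ((\<Sum>i<n. h *\<^sub>C d i x) - h *\<^sub>C D x) \<le> \<epsilon> * norm h"
    proof eventually_elim
      case (elim n)
      show ?case
      proof (intro ballI allI)
        fix x h :: complex
        assume "x \<in> ball 0 \<rho>"
        with elim have "norm ((\<Sum>i<n. d i x) - D x) \<le> \<epsilon>"
          by (auto simp: dist_norm intro: less_imp_le)
        then have "cmod h * norm ((\<Sum>i<n. d i x) - D x) \<le> cmod h * \<epsilon>"
          by (rule mult_left_mono) simp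
        moreover have "(\<Sum>i<n. h *\<^sub>C d i x) - h *\<^sub>C D x = h *\<^sub>C ((\<Sum>i<n. d i x) - D x)"
          by (simp only: scaleC_sum_right complex_vector.scale_right_diff_distrib)
        ultimately show "norm ((\<Sum>i<n. h *\<^sub>C d i x) - h *\<^sub>C D x) \<le> \<epsilon> * norm h"
          by (simp only: norm_scaleC mult.commute[of \<epsilon>])
      qed
    qed
  qed simp
  then obtain g where g: "\<And>x. x \<in> ball 0 \<rho> \<Longrightarrow> (\<lambda>n. x ^ n *\<^sub>C c n) sums g x"
    and g': "\<And>x. x \<in> ball 0 \<rho> \<Longrightarrow> (g has_derivative (\<lambda>h. h *\<^sub>C D x)) (at x within ball 0 \<rho>)"
    by blast
  have zr: "z \<in> ball 0 \<rho>"
    using rs by simp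
  have "(g has_derivative (\<lambda>h. h *\<^sub>C D z)) (at z)"
    using g'[OF zr] by (simp only: at_within_open[OF zr open_ball])
  \<comment> \<open>\<open>has_derivative_series\<close> yields only some sum function
    \<open>g\<close>; uniqueness of sums identifies it with \<open>f\<close> on the small
    disc.\<close>
  then have "(f has_derivative (\<lambda>h. h *\<^sub>C D z)) (at z)"
    by (rule has_derivative_transform_within_open[OF _ open_ball zr])
      (rule sums_unique2[OF g sums])
  then have cd: "cderiv f z = D z"
    by (rule cderiv_eqI)
  have "(\<lambda>n. d n z) sums D z"
    unfolding D_def using d_le[OF zr]
    by (intro summable_sums summable_comparison_test'[OF \<open>summable m\<close>])
  then have "(\<lambda>n. z *\<^sub>C d n z) sums (z *\<^sub>C D z)"
    by (rule bounded_linear.sums[OF bounded_linear_scaleC])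
  then have "(\<lambda>n. z *\<^sub>C d n z + z ^ n *\<^sub>C c n) sums (z *\<^sub>C D z + f z)"
    by (rule sums_add) (rule sums[OF zr])
  moreover have "z *\<^sub>C d n z + z ^ n *\<^sub>C c n = z ^ n *\<^sub>C of_nat (Suc n) *\<^sub>C c n" for n
  proof -
    \<comment> \<open>At \<open>n = 0\<close> the truncated exponent \<open>n - 1\<close> is
      harmless because of the factor \<open>of_nat n\<close>.\<close>
    have "z * (of_nat n * z ^ (n - 1)) + z ^ n = z ^ n * of_nat (Suc n)"
      by (cases n) (simp_all add: algebra_simps)
    then show ?thesis
      by (simp only: d_def scaleC_scaleC scaleC_add_left[symmetric])
  qed
  ultimately show ?thesis
    by (simp add: D_op_def cd)
qed

subsection \<open>Weighted Hilbert matrices\<close>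

text \<open>The weight splits as \<open>Suc (q k)\<close> plus \<open>q m\<close>. In the first part
  each row is \<open>z ^ q k\<close> times the polynomial \<open>w k\<close>, to which
  \<open>nn_integral_disc_poly\<close> applies; the coefficients of all the \<open>w k\<close> at
  one frequency come from a vector acted on by Hilbert's matrix. In the second part
  \<open>z ^ q k\<close> is dropped, Hilbert's inequality is used pointwise in \<open>z\<close>, and
  \<open>nn_integral_disc_poly\<close> is applied to each column.\<close>

lemma nn_integral_disc_hilbert_poly:
  fixes b :: "nat \<Rightarrow> nat \<Rightarrow> complex" and q :: "nat \<Rightarrow> nat"
  assumes q: "\<And>m. 1 \<le> q m"
  shows "(\<integral>\<^sup>+z\<in>ball 0 1. ennreal ((\<Sum>k<K. (cmod (\<Sum>m<K.
      of_nat (Suc (q k + q m)) * z ^ (q k + q m) * (\<Sum>l<N. b l m * z ^ l) / of_int (int k - int m)))\<^sup>2)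
      * (1 - (cmod z)\<^sup>2)) \<partial>lborel)
    \<le> ennreal (10 * pi ^ 3 * (\<Sum>l<N. \<Sum>m<K. (cmod (b l m))\<^sup>2))"
proof -
  \<comment> \<open>\<open>L\<close> exceeds every frequency of the shifted polynomials
    \<open>z ^ q m * v m z\<close> with \<open>m < K\<close>, and \<open>u n m\<close> is the
    coefficient of \<open>z ^ n\<close> in them. The test \<open>q m \<le> n\<close> guards the
    truncated subtraction.\<close>
  define L where "L = N + (\<Sum>m<K. q m)"
  define u where "u = (\<lambda>n m. if q m \<le> n \<and> n - q m < N then b (n - q m) m else 0)"
  define h where "h = (\<lambda>k m :: nat. 1 / complex_of_int (int k - int m))"
  define p where "p = (\<lambda>k n. \<Sum>m<K. u n m * h k m)"
  define v where "v = (\<lambda>m z. \<Sum>l<N. b l m * z ^ l)"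
  define w where "w = (\<lambda>k z. \<Sum>n<L. p k n * z ^ n)"
  define B where "B = (\<Sum>l<N. \<Sum>m<K. (cmod (b l m))\<^sup>2)"
  define P where "P = (\<lambda>a (g :: complex \<Rightarrow> complex) z. (real a * cmod (z ^ a * g z))\<^sup>2)"
  \<comment> \<open>A general \<open>g\<close> lets the same reindexing serve both the polynomials
    and the sums of their squared coefficients.\<close>
  have sum_shift: "(\<Sum>n<L. g (if q m \<le> n \<and> n - q m < N then b (n - q m) m else 0) n)
      = (\<Sum>l<N. g (b l m) (l + q m))"
    if "m < K" "\<And>n. g 0 n = 0" for m and g :: "complex \<Rightarrow> nat \<Rightarrow> 'c::comm_monoid_add"
  proof -
    have "q m \<le> (\<Sum>m<K. q m)"
      using that by (intro member_le_sum) auto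
    then have "(\<Sum>l<N. g (b l m) (l + q m))
        = (\<Sum>n\<in>{n. q m \<le> n \<and> n - q m < N}. g (b (n - q m) m) n)"
      by (intro sum.reindex_bij_witness[of _ "\<lambda>n. n - q m" "\<lambda>l. l + q m"]) auto
    also have "\<dots> = (\<Sum>n<L. g (if q m \<le> n \<and> n - q m < N then b (n - q m) m else 0) n)"
      using that(2) \<open>q m \<le> _\<close> by (intro sum.mono_neutral_cong_left) (auto simp: L_def)
    finally show ?thesis ..
  qed
  have shift: "z ^ q m * v m z = (\<Sum>n<L. u n m * z ^ n)" if "m < K" for m z
    using sum_shift[OF that, of "\<lambda>c n. c * z ^ n"]
    by (simp add: u_def v_def sum_distrib_left power_add mult_ac)
  have w: "w k z = (\<Sum>m<K. (z ^ q m * v m z) * h k m)" for k z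
  proof -
    have "w k z = (\<Sum>n<L. \<Sum>m<K. u n m * h k m * z ^ n)"
      by (simp add: w_def p_def sum_distrib_right)
    also have "\<dots> = (\<Sum>m<K. \<Sum>n<L. u n m * h k m * z ^ n)"
      by (rule sum.swap)
    also have "\<dots> = (\<Sum>m<K. (z ^ q m * v m z) * h k m)"
      by (intro sum.cong refl) (subst shift, auto simp: sum_distrib_left sum_distrib_right mult_ac)
    finally show ?thesis .
  qed
  have pointwise: "(\<Sum>k<K. (cmod (\<Sum>m<K.
      of_nat (Suc (q k + q m)) * z ^ (q k + q m) * v m z / of_int (int k - int m)))\<^sup>2)
    \<le> 8 * (\<Sum>k<K. P (q k) (w k) z) + 2 * pi\<^sup>2 * (\<Sum>m<K. P (q m) (v m) z)" if "cmod z \<le> 1" for z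
  proof -
    define E where "E = (\<lambda>k. \<Sum>m<K. (of_nat (q m) * (z ^ q m * v m z)) / complex_of_int (int k - int m))"
    \<comment> \<open>The constant \<open>8\<close> is \<open>2 * 2 ^ 2\<close>: one factor
      \<open>2\<close> from \<open>(x + y)^2 \<le> 2 * x^2 + 2 * y^2\<close>, the squared one from
      \<open>Suc (q k) \<le> 2 * q k\<close>, where \<open>1 \<le> q k\<close> enters.\<close>
    have "(cmod (\<Sum>m<K. of_nat (Suc (q k + q m)) * z ^ (q k + q m) * v m z / of_int (int k - int m)))\<^sup>2
        \<le> 8 * P (q k) (w k) z + 2 * (cmod (E k))\<^sup>2" for k
    proof -
      have "(\<Sum>m<K. of_nat (Suc (q k + q m)) * z ^ (q k + q m) * v m z / of_int (int k - int m))
          = (\<Sum>m<K. of_nat (Suc (q k)) * z ^ q k * ((z ^ q m * v m z) * h k m)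
              + z ^ q k * ((of_nat (q m) * (z ^ q m * v m z)) / of_int (int k - int m)))"
        by (intro sum.cong refl) (simp add: h_def power_add divide_inverse algebra_simps del: of_int_diff)
      also have "\<dots> = of_nat (Suc (q k)) * z ^ q k * w k z + z ^ q k * E k"
        by (simp only: sum.distrib w E_def sum_distrib_left)
      finally have "cmod (\<Sum>m<K. of_nat (Suc (q k + q m)) * z ^ (q k + q m) * v m z / of_int (int k - int m))
          \<le> cmod (of_nat (Suc (q k)) * z ^ q k * w k z) + cmod (z ^ q k * E k)"
        by (metis norm_triangle_ineq)
      also have "\<dots> \<le> 2 * (real (q k) * cmod (z ^ q k * w k z)) + cmod (E k)"
      proof (rule add_mono)
        have "real (Suc (q k)) * cmod (z ^ q k * w k z) \<le> 2 * real (q k) * cmod (z ^ q k * w k z)"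
          using q[of k] by (intro mult_right_mono) auto
        then show "cmod (of_nat (Suc (q k)) * z ^ q k * w k z) \<le> 2 * (real (q k) * cmod (z ^ q k * w k z))"
          by (simp only: norm_mult norm_of_nat mult.assoc)
        show "cmod (z ^ q k * E k) \<le> cmod (E k)"
          using that by (simp add: norm_mult norm_power mult_left_le_one_le power_le_one)
      qed
      finally have "(cmod (\<Sum>m<K. of_nat (Suc (q k + q m)) * z ^ (q k + q m) * v m z / of_int (int k - int m)))\<^sup>2
          \<le> (2 * (real (q k) * cmod (z ^ q k * w k z)) + cmod (E k))\<^sup>2"
        by (rule power_mono) simp
      also have "\<dots> \<le> 2 * (2 * (real (q k) * cmod (z ^ q k * w k z)))\<^sup>2 + 2 * (cmod (E k))\<^sup>2"
        using sum_squares_bound[of "2 * (real (q k) * cmod (z ^ q k * w k z))" "cmod (E k)"]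
        by (simp add: power2_sum)
      finally show ?thesis
        by (simp add: P_def power_mult_distrib)
    qed
    then have "(\<Sum>k<K. (cmod (\<Sum>m<K.
        of_nat (Suc (q k + q m)) * z ^ (q k + q m) * v m z / of_int (int k - int m)))\<^sup>2)
      \<le> (\<Sum>k<K. 8 * P (q k) (w k) z + 2 * (cmod (E k))\<^sup>2)"
      by (intro sum_mono)
    also have "\<dots> = 8 * (\<Sum>k<K. P (q k) (w k) z) + 2 * (\<Sum>k<K. (cmod (E k))\<^sup>2)"
      by (simp add: sum.distrib sum_distrib_left)
    also have "(\<Sum>k<K. (cmod (E k))\<^sup>2) \<le> pi\<^sup>2 * (\<Sum>m<K. P (q m) (v m) z)"
      using Hilbert_inequality[where K = K and x = "\<lambda>m. of_nat (q m) * (z ^ q m * v m z)"]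
      by (simp add: E_def P_def norm_mult)
    finally show ?thesis
      by simp
  qed
  have P_nonneg: "0 \<le> P a g z" for a g z
    by (simp add: P_def)
  have P_int: "(\<integral>\<^sup>+z\<in>ball 0 1. ennreal (P a (\<lambda>z. \<Sum>n<M. c n * z ^ n) z * (1 - (cmod z)\<^sup>2)) \<partial>lborel)
      \<le> ennreal (pi * (\<Sum>n<M. (cmod (c n))\<^sup>2))" for a M c
    unfolding P_def by (rule nn_integral_disc_poly)
  have [measurable]: "(\<lambda>z. P a (w k) z) \<in> borel_measurable borel"
    "(\<lambda>z. P a (v k) z) \<in> borel_measurable borel" for a k
    unfolding P_def w_def v_def
    by (auto intro!: borel_measurable_continuous_onI continuous_intros)
  have [measurable]: "(\<lambda>z::complex. 1 - (cmod z)\<^sup>2) \<in> borel_measurable borel"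
    "ball (0::complex) 1 \<in> sets borel"
    by (auto intro!: borel_measurable_continuous_onI continuous_intros)
  have "(\<integral>\<^sup>+z\<in>ball 0 1. ennreal ((\<Sum>k<K. (cmod (\<Sum>m<K.
      of_nat (Suc (q k + q m)) * z ^ (q k + q m) * v m z / of_int (int k - int m)))\<^sup>2)
      * (1 - (cmod z)\<^sup>2)) \<partial>lborel)
    \<le> (\<integral>\<^sup>+z. (\<Sum>k<K. ennreal 8 * (ennreal (P (q k) (w k) z * (1 - (cmod z)\<^sup>2)) * indicator (ball 0 1) z))
        + (\<Sum>m<K. ennreal (2 * pi\<^sup>2) * (ennreal (P (q m) (v m) z * (1 - (cmod z)\<^sup>2)) * indicator (ball 0 1) z)) \<partial>lborel)"
  proof (rule nn_integral_mono)
    fix z :: complex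
    define D where "D = (\<Sum>k<K. (cmod (\<Sum>m<K.
      of_nat (Suc (q k + q m)) * z ^ (q k + q m) * v m z / of_int (int k - int m)))\<^sup>2)"
    show "ennreal (D * (1 - (cmod z)\<^sup>2)) * indicator (ball 0 1) z
      \<le> (\<Sum>k<K. ennreal 8 * (ennreal (P (q k) (w k) z * (1 - (cmod z)\<^sup>2)) * indicator (ball 0 1) z))
        + (\<Sum>m<K. ennreal (2 * pi\<^sup>2) * (ennreal (P (q m) (v m) z * (1 - (cmod z)\<^sup>2)) * indicator (ball 0 1) z))"
    proof (cases "z \<in> ball 0 1")
      case True
      then have z: "cmod z \<le> 1" and z2: "0 \<le> 1 - (cmod z)\<^sup>2"
        by (simp_all add: abs_square_le_1)
      have "D * (1 - (cmod z)\<^sup>2)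
          \<le> (8 * (\<Sum>k<K. P (q k) (w k) z) + 2 * pi\<^sup>2 * (\<Sum>m<K. P (q m) (v m) z)) * (1 - (cmod z)\<^sup>2)"
        unfolding D_def by (rule mult_right_mono[OF pointwise[OF z] z2])
      also have "\<dots> = (\<Sum>k<K. 8 * (P (q k) (w k) z * (1 - (cmod z)\<^sup>2)))
          + (\<Sum>m<K. 2 * pi\<^sup>2 * (P (q m) (v m) z * (1 - (cmod z)\<^sup>2)))"
        by (simp only: distrib_right sum_distrib_left sum_distrib_right mult.assoc)
      finally have "ennreal (D * (1 - (cmod z)\<^sup>2)) \<le> ennreal \<dots>"
        by (rule ennreal_leI)
      also have "\<dots> = (\<Sum>k<K. ennreal 8 * ennreal (P (q k) (w k) z * (1 - (cmod z)\<^sup>2)))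
        + (\<Sum>m<K. ennreal (2 * pi\<^sup>2) * ennreal (P (q m) (v m) z * (1 - (cmod z)\<^sup>2)))"
        using z2 P_nonneg
        by (simp add: ennreal_plus[symmetric] sum_nonneg sum_ennreal ennreal_mult[symmetric]
            del: ennreal_numeral ennreal_plus)
      finally show ?thesis
        using True by simp
    qed simp
  qed
  also have "\<dots> = (\<Sum>k<K. ennreal 8 *
        (\<integral>\<^sup>+z\<in>ball 0 1. ennreal (P (q k) (w k) z * (1 - (cmod z)\<^sup>2)) \<partial>lborel))
      + (\<Sum>m<K. ennreal (2 * pi\<^sup>2) *
        (\<integral>\<^sup>+z\<in>ball 0 1. ennreal (P (q m) (v m) z * (1 - (cmod z)\<^sup>2)) \<partial>lborel))"
    by (simp add: nn_integral_add nn_integral_sum nn_integral_cmult del: ennreal_numeral)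
  also have "\<dots> \<le> (\<Sum>k<K. ennreal 8 * ennreal (pi * (\<Sum>n<L. (cmod (p k n))\<^sup>2)))
      + (\<Sum>m<K. ennreal (2 * pi\<^sup>2) * ennreal (pi * (\<Sum>l<N. (cmod (b l m))\<^sup>2)))"
    unfolding w_def v_def by (intro add_mono sum_mono mult_left_mono P_int) auto
  also have "\<dots> = ennreal (8 * pi * (\<Sum>k<K. \<Sum>n<L. (cmod (p k n))\<^sup>2)
      + 2 * pi ^ 3 * (\<Sum>m<K. \<Sum>l<N. (cmod (b l m))\<^sup>2))"
    by (simp add: ennreal_mult[symmetric] sum_ennreal sum_nonneg ennreal_plus[symmetric]
        sum_distrib_left power2_eq_square power3_eq_cube mult_ac del: ennreal_numeral ennreal_plus)
  also have "\<dots> \<le> ennreal (10 * pi ^ 3 * B)"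
  proof (rule ennreal_leI)
    have "(\<Sum>k<K. \<Sum>n<L. (cmod (p k n))\<^sup>2) = (\<Sum>n<L. \<Sum>k<K. (cmod (p k n))\<^sup>2)"
      by (rule sum.swap)
    \<comment> \<open>Hilbert's inequality for each frequency \<open>n\<close> separately. Together
      with the factor \<open>pi\<close> from \<open>nn_integral_disc_poly\<close> this gives
      \<open>pi ^ 3\<close> in both parts, and \<open>10 = 8 + 2\<close>.\<close>
    also have "\<dots> \<le> (\<Sum>n<L. pi\<^sup>2 * (\<Sum>m<K. (cmod (u n m))\<^sup>2))"
    proof (rule sum_mono)
      show "(\<Sum>k<K. (cmod (p k n))\<^sup>2) \<le> pi\<^sup>2 * (\<Sum>m<K. (cmod (u n m))\<^sup>2)" for n
        using Hilbert_inequality[where K = K and x = "u n"] by (simp add: p_def h_def)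
    qed
    also have "\<dots> = pi\<^sup>2 * (\<Sum>m<K. \<Sum>n<L. (cmod (u n m))\<^sup>2)"
      unfolding sum_distrib_left[symmetric] by (subst sum.swap) simp
    also have "(\<Sum>m<K. \<Sum>n<L. (cmod (u n m))\<^sup>2) = (\<Sum>m<K. \<Sum>l<N. (cmod (b l m))\<^sup>2)"
      unfolding u_def by (intro sum.cong refl sum_shift) auto
    also have B_swap: "(\<Sum>m<K. \<Sum>l<N. (cmod (b l m))\<^sup>2) = B"
      unfolding B_def by (rule sum.swap)
    finally have "8 * pi * (\<Sum>k<K. \<Sum>n<L. (cmod (p k n))\<^sup>2) \<le> 8 * pi * (pi\<^sup>2 * B)"
      by (intro mult_left_mono) auto
    then show "8 * pi * (\<Sum>k<K. \<Sum>n<L. (cmod (p k n))\<^sup>2) + 2 * pi ^ 3 * (\<Sum>m<K. \<Sum>l<N. (cmod (b l m))\<^sup>2)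
        \<le> 10 * pi ^ 3 * B"
      unfolding B_swap by (simp add: power2_eq_square power3_eq_cube mult_ac)
  qed
  finally show ?thesis
    unfolding v_def B_def .
qed

text \<open>For the radii in question the terms with \<open>m < k\<close> all have size about \<open>4 ^ k / (k - m)\<close>,
  while those with \<open>m > k\<close> decay geometrically relative to \<open>4 ^ k\<close>.\<close>

lemma Hilbert_row_lower_bound:
  fixes t :: real
  assumes k: "k < N" and t: "1 - 1 / (2 * 4 ^ k) < t" "t < 1 - 1 / (4 * 4 ^ k)"
  shows "4 ^ k * (harm k / 2 - 22)
    \<le> (\<Sum>m<N. real (Suc (4 ^ k + 4 ^ m)) * t ^ (4 ^ m) / of_int (int k - int m))"
proof -
  define g where "g = (\<lambda>m. real (Suc (4 ^ k + 4 ^ m)) * t ^ (4 ^ m) / of_int (int k - int m))"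
  have "1 / (2 * 4 ^ k) \<le> (1 / 2 :: real)"
    by (simp add: field_simps)
  with t have t0: "1 / 2 < t"
    by linarith
  \<comment> \<open>In terms of \<open>d\<close> the range is \<open>1 - d < t < 1 - d / 2\<close>.
    Its lower end keeps \<open>t ^ 4 ^ m\<close> at least \<open>1 / 2\<close> for
    \<open>m < k\<close>, by Bernoulli; its upper end damps the columns with
    \<open>m > k\<close>.\<close>
  define d :: real where "d = 1 / (2 * 4 ^ k)"
  have d: "0 < d" "d \<le> 1 / 2" "1 - d < t" "t < 1 - d / 2"
    using t \<open>1 / (2 * 4 ^ k) \<le> 1 / 2\<close> by (simp_all add: d_def)
  have low: "4 ^ k / 2 * (1 / real (k - m)) \<le> g m" if "m < k" for m
  proof -
    have "1 + real (4 ^ m) * (- d) \<le> (1 + - d) ^ (4 ^ m)"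
      using d by (intro Bernoulli_inequality) linarith
    also have "\<dots> \<le> t ^ (4 ^ m)"
      using d by (intro power_mono) linarith+
    finally have "1 - 4 ^ m * d \<le> t ^ (4 ^ m)"
      by simp
    moreover have "(4::real) ^ m \<le> 4 ^ k"
      using that by (intro power_increasing) auto
    then have "4 ^ m * d \<le> 1 / 2"
      by (simp add: d_def field_simps)
    ultimately have "1 / 2 \<le> t ^ (4 ^ m)"
      by linarith
    then have "4 ^ k * (1 / 2) \<le> real (Suc (4 ^ k + 4 ^ m)) * t ^ (4 ^ m)"
      by (intro mult_mono) auto
    then have "4 ^ k * (1 / 2) / real (k - m) \<le> real (Suc (4 ^ k + 4 ^ m)) * t ^ (4 ^ m) / real (k - m)"
      by (rule divide_right_mono) simp
    then show ?thesis
      using that by (simp add: g_def of_nat_diff)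
  qed
  have high: "- (16 * 4 ^ k * (1 / 4) ^ (m - Suc k)) \<le> g m" if "k < m" for m
  proof -
    define j where "j = m - Suc k"
    have m: "m = k + Suc j"
      using that by (simp add: j_def)
    define y :: real where "y = 4 ^ j"
    have y: "y > 0"
      by (simp add: y_def)
    have my: "(4::real) ^ m = 4 * 4 ^ k * y"
      by (simp add: m y_def power_add)
    have "t ^ (4 ^ m) \<le> exp (- (d / 2)) ^ (4 ^ m)"
      using d t0 exp_ge_add_one_self[of "- (d / 2)"] by (intro power_mono) linarith+
    also have "\<dots> = exp (real (4 ^ m) * (- (d / 2)))"
      by (rule exp_of_nat_mult[symmetric])
    also have "real (4 ^ m) * (- (d / 2)) = - y"
      by (simp add: my d_def)
    \<comment> \<open>The weight grows like \<open>y = 4 ^ j\<close>, so the bound needs a decay of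
      order \<open>1 / y^2\<close> to leave the summable factor \<open>1 / y\<close>.\<close>
    also have "exp (- y) \<le> 2 / y\<^sup>2"
    proof -
      have "y\<^sup>2 / 2 \<le> exp y"
        using exp_lower_Taylor_quadratic[of y] y by simp
      then show ?thesis
        using y frac_le[of 1 1 "y\<^sup>2 / 2" "exp y"] by (simp add: exp_minus inverse_eq_divide)
    qed
    finally have ty: "t ^ (4 ^ m) \<le> 2 / y\<^sup>2" .
    have "1 + (4::real) ^ k \<le> 4 * 4 ^ k * y"
    proof -
      have "(1::real) \<le> 4 ^ k" "1 \<le> y"
        by (simp_all add: y_def)
      then have "4 * 4 ^ k * 1 \<le> 4 * 4 ^ k * y"
        by (intro mult_left_mono) auto
      then show ?thesis
        using \<open>1 \<le> 4 ^ k\<close> by linarith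
    qed
    then have "real (Suc (4 ^ k + 4 ^ m)) \<le> 8 * 4 ^ k * y"
      by (simp add: my algebra_simps)
    then have "real (Suc (4 ^ k + 4 ^ m)) * t ^ (4 ^ m) \<le> 8 * 4 ^ k * y * (2 / y\<^sup>2)"
      using ty y t0 by (intro mult_mono) auto
    also have "\<dots> = 16 * 4 ^ k * (1 / 4) ^ j"
      using y by (simp add: power2_eq_square y_def field_simps power_one_over)
    finally have a: "real (Suc (4 ^ k + 4 ^ m)) * t ^ (4 ^ m) \<le> 16 * 4 ^ k * (1 / 4) ^ j" .
    have "real (Suc (4 ^ k + 4 ^ m)) * t ^ (4 ^ m) / real (Suc j)
        \<le> real (Suc (4 ^ k + 4 ^ m)) * t ^ (4 ^ m) / 1"
      using t0 by (intro divide_left_mono) auto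
    moreover have "g m = - (real (Suc (4 ^ k + 4 ^ m)) * t ^ (4 ^ m) / real (Suc j))"
      by (simp add: g_def m minus_divide_right)
    ultimately show ?thesis
      using a by (simp add: j_def)
  qed
  have "sum g {..<N} = sum g {..<k} + (g k + sum g {k<..<N})"
  proof -
    have "{..<N} = {..<k} \<union> insert k {k<..<N}"
      using k by auto
    moreover have "sum g ({..<k} \<union> insert k {k<..<N}) = sum g {..<k} + sum g (insert k {k<..<N})"
      by (rule sum.union_disjoint) auto
    ultimately show ?thesis
      by simp
  qed
  moreover have "g k = 0"
    by (simp add: g_def)
  moreover have "4 ^ k * (harm k / 2) \<le> sum g {..<k}"
  proof -
    have "4 ^ k * (harm k / 2) = 4 ^ k / 2 * (\<Sum>m<k. 1 / real (k - m))"
    proof -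
      have "harm k = (\<Sum>m<k. 1 / real (k - m))"
        unfolding harm_def inverse_eq_divide
        by (rule sum.reindex_bij_witness[of _ "\<lambda>m. k - m" "\<lambda>m. k - m"]) auto
      then show ?thesis
        by simp
    qed
    also have "\<dots> \<le> sum g {..<k}"
      unfolding sum_distrib_left using low by (intro sum_mono) auto
    finally show ?thesis .
  qed
  \<comment> \<open>\<open>22\<close> rounds up \<open>16 * 4 / 3\<close>, the total of the
    geometric bounds in \<open>high\<close>.\<close>
  moreover have "- (4 ^ k * 22) \<le> sum g {k<..<N}"
  proof -
    have "(\<Sum>m\<in>{k<..<N}. (1 / 4) ^ (m - Suc k)) = (\<Sum>j<N - Suc k. (1 / 4 :: real) ^ j)"
      by (rule sum.reindex_bij_witness[of _ "\<lambda>j. j + Suc k" "\<lambda>m. m - Suc k"]) auto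
    also have "\<dots> \<le> (\<Sum>j. (1 / 4) ^ j)"
      by (intro sum_le_suminf summable_geometric) auto
    also have "\<dots> = 4 / 3"
      by (simp add: suminf_geometric)
    finally have "- (16 * 4 ^ k * (4 / 3)) \<le> - (16 * 4 ^ k * (\<Sum>m\<in>{k<..<N}. (1 / 4 :: real) ^ (m - Suc k)))"
      by simp
    also have "\<dots> = (\<Sum>m\<in>{k<..<N}. - (16 * 4 ^ k * (1 / 4) ^ (m - Suc k)))"
      by (simp add: sum_distrib_left sum_negf)
    also have "\<dots> \<le> sum g {k<..<N}"
      using high by (intro sum_mono) auto
    finally have "- (16 * 4 ^ k * (4 / 3)) \<le> sum g {k<..<N}" .
    moreover have "(0::real) < 4 ^ k"
      by simp
    ultimately show ?thesis
      by linarith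
  qed
  ultimately show ?thesis
    by (simp add: g_def algebra_simps)
qed

subsection \<open>The operator-valued symbol\<close>

text \<open>The Taylor coefficient at frequency \<open>n\<close>: all matrix entries with
  \<open>4 ^ k + 4 ^ m = n\<close> are collected. By \<open>exponent_pairs_subset\<close> there are
  finitely many, so this is a genuine sum.\<close>

definition hilbert_coeff :: "(nat \<Rightarrow> 'a::complex_hilbert_space) \<Rightarrow> nat \<Rightarrow> 'a cblinop"
  where "hilbert_coeff e n = (\<Sum>(k, m)\<in>{(k, m). 4 ^ k + 4 ^ m = n}.
    (1 / of_int (int k - int m)) *\<^sub>C rank_one (e k) (e m))"

definition hilbert_symbol :: "(nat \<Rightarrow> 'a::complex_hilbert_space) \<Rightarrow> complex \<Rightarrow> 'a cblinop"
  where "hilbert_symbol e z = (\<Sum>n. z ^ n *\<^sub>C hilbert_coeff e n)"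

lemma exponent_pairs_subset: "{(k, m). 4 ^ k + 4 ^ m = n} \<subseteq> {..<n} \<times> {..<n :: nat}"
proof
  fix x
  assume "x \<in> {(k, m). 4 ^ k + 4 ^ m = n}"
  then obtain k m where x: "x = (k, m)" "4 ^ k + 4 ^ m = n"
    by blast
  have "i < (4 :: nat) ^ i" for i
    by (rule power_gt_expt) simp
  from this[of k] this[of m] show "x \<in> {..<n} \<times> {..<n}"
    using x by auto
qed

text \<open>A crude count: every entry has norm at most \<open>1\<close>, and \<open>k\<close>
  determines \<open>m\<close>. Linear growth already gives convergence in the open disc; boundedness
  of the symbol needs Hilbert's inequality.\<close>

lemma norm_hilbert_coeff_le:
  assumes "orthonormal_on UNIV e"
  shows "norm (hilbert_coeff e n) \<le> real n"
proof -
  define A where "A = {(k, m). (4 :: nat) ^ k + 4 ^ m = n}"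
  have norm_e: "norm (e i) = 1" for i
  proof -
    have "complex_of_real ((norm (e i))\<^sup>2) = of_real 1"
      unfolding cinner_self[symmetric] using assms by (simp add: orthonormal_on_def)
    then have "(norm (e i))\<^sup>2 = 1"
      by (simp only: of_real_eq_iff)
    then show ?thesis
      by (simp add: power2_eq_1_iff) (use norm_ge_zero[of "e i"] in linarith)
  qed
  have term_le: "norm ((1 / of_int (int k - int m)) *\<^sub>C rank_one (e k) (e m)) \<le> 1" for k m
  proof -
    have "cmod (1 / of_int (int k - int m)) \<le> 1"
    proof (cases "k = m")
      case False
      then have "1 \<le> \<bar>real_of_int (int k - int m)\<bar>"
        by linarith
      then show ?thesis
        by (simp add: norm_divide divide_le_eq_1 del: of_int_diff)
    qed simp
    moreover have "norm (rank_one (e k) (e m)) \<le> 1"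
      using norm_rank_one_le[of "e k" "e m"] by (simp add: norm_e)
    ultimately show ?thesis
      unfolding norm_scaleC by (intro mult_le_one) auto
  qed
  have "norm (hilbert_coeff e n) \<le> (\<Sum>x\<in>A. 1)"
    unfolding hilbert_coeff_def A_def[symmetric]
    by (rule sum_norm_le) (use term_le in auto)
  also have "\<dots> = real (card A)"
    by simp
  also have "card A \<le> card {..<n}"
  proof (rule card_inj_on_le)
    show "inj_on fst A"
      by (auto simp: A_def inj_on_def)
    show "fst ` A \<subseteq> {..<n}"
      using exponent_pairs_subset[of n] by (auto simp: A_def)
  qed simp
  finally show ?thesis
    by simp
qed

lemma has_power_series_hilbert_symbol:
  assumes "orthonormal_on UNIV (e :: nat \<Rightarrow> 'a::complex_hilbert_space)"
  shows "has_power_series_on_disc (hilbert_symbol e) (hilbert_coeff e) 1"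
  unfolding has_power_series_on_disc_def
proof
  fix z :: complex
  assume "z \<in> ball 0 1"
  then have "summable (\<lambda>n. real (Suc n) * cmod z ^ n)"
    by (intro sums_summable[OF geometric_deriv_sums]) simp
  then have "summable (\<lambda>n. z ^ n *\<^sub>C hilbert_coeff e n)"
  proof (rule summable_comparison_test')
    show "norm (z ^ n *\<^sub>C hilbert_coeff e n) \<le> real (Suc n) * cmod z ^ n" for n
    proof -
      have "norm (hilbert_coeff e n) \<le> real (Suc n)"
        using norm_hilbert_coeff_le[OF assms, of n] by simp
      then show ?thesis
        unfolding norm_scaleC norm_power mult.commute[of "real (Suc n)"]
        by (rule mult_left_mono) simp
    qed
  qed
  then show "(\<lambda>n. z ^ n *\<^sub>C hilbert_coeff e n) sums hilbert_symbol e z"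
    unfolding hilbert_symbol_def by (rule summable_sums)
qed

text \<open>Every exponent \<open>4 ^ k + 4 ^ m\<close> is less than \<open>4 ^ K\<close> exactly when \<open>k, m < K\<close>, so suitable partial
  sums of the power series are compressions of the whole operator matrix.\<close>

lemma hilbert_partial_sum_apply:
  fixes a :: "nat \<Rightarrow> complex"
  shows "cblinop_apply (\<Sum>n<4 ^ K. a n *\<^sub>C hilbert_coeff e n) x
    = (\<Sum>k<K. (\<Sum>m<K. a (4 ^ k + 4 ^ m) * cinner x (e m) / of_int (int k - int m)) *\<^sub>C e k)"
proof -
  define g where "g = (\<lambda>(k, m). (4 :: nat) ^ k + 4 ^ m)"
  \<comment> \<open>The scalars \<open>a\<close> stay arbitrary so that one formula covers both
    \<open>z ^ n\<close> for the symbol and \<open>(n + 1) * z ^ n\<close> for its image under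
    \<open>D_op\<close>.\<close>
  define T where "T = (\<lambda>(k, m). (a (4 ^ k + 4 ^ m) / of_int (int k - int m)) *\<^sub>C rank_one (e k) (e m))"
  have g_less: "g (k, m) < 4 ^ K \<longleftrightarrow> k < K \<and> m < K" for k m
  proof
    assume "g (k, m) < 4 ^ K"
    then have "(4 :: nat) ^ k + 4 ^ m < 4 ^ K"
      by (simp add: g_def)
    then have "(4 :: nat) ^ k < 4 ^ K" "(4 :: nat) ^ m < 4 ^ K"
      by linarith+
    then show "k < K \<and> m < K"
      by simp
  next
    assume km: "k < K \<and> m < K"
    then obtain K' where K': "K = Suc K'"
      by (cases K) auto
    then have "(4 :: nat) ^ k \<le> 4 ^ K'" "(4 :: nat) ^ m \<le> 4 ^ K'"
      using km by (auto intro!: power_increasing)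
    \<comment> \<open>Two powers below \<open>4 ^ K\<close> add up to at most
      \<open>2 * 4 ^ K'\<close>, strictly less than \<open>4 * 4 ^ K'\<close>.\<close>
    moreover have "(0 :: nat) < 4 ^ K'"
      by simp
    ultimately have "(4 :: nat) ^ k + 4 ^ m < 4 * 4 ^ K'"
      by linarith
    then show "g (k, m) < 4 ^ K"
      by (simp add: g_def K')
  qed
  have "(\<Sum>n<4 ^ K. a n *\<^sub>C hilbert_coeff e n)
      = (\<Sum>n<4 ^ K. \<Sum>x\<in>{x \<in> {..<K} \<times> {..<K}. g x = n}. T x)"
  proof (rule sum.cong[OF refl])
    fix n :: nat
    assume "n \<in> {..<4 ^ K}"
    then have eq: "{x \<in> {..<K} \<times> {..<K}. g x = n} = {(k, m). 4 ^ k + 4 ^ m = n}"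
      using g_less by (auto simp: g_def)
    show "a n *\<^sub>C hilbert_coeff e n = (\<Sum>x\<in>{x \<in> {..<K} \<times> {..<K}. g x = n}. T x)"
      unfolding hilbert_coeff_def scaleC_sum_right eq
    proof (rule sum.cong[OF refl])
      fix x :: "nat \<times> nat"
      assume "x \<in> {(k, m). 4 ^ k + 4 ^ m = n}"
      then obtain k m where "x = (k, m)" "4 ^ k + 4 ^ m = n"
        by blast
      then show "a n *\<^sub>C (case x of (k, m) \<Rightarrow> (1 / of_int (int k - int m)) *\<^sub>C rank_one (e k) (e m)) = T x"
        by (simp add: T_def scaleC_scaleC del: of_int_diff)
    qed
  qed
  also have "\<dots> = sum T ({..<K} \<times> {..<K})"
  proof (rule sum.group[of "{..<K} \<times> {..<K}" "{..<4 ^ K}" g T])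
    show "g ` ({..<K} \<times> {..<K}) \<subseteq> {..<4 ^ K}"
    proof
      fix n
      assume "n \<in> g ` ({..<K} \<times> {..<K})"
      then obtain x where x: "n = g x" "x \<in> {..<K} \<times> {..<K}"
        by (rule imageE)
      then show "n \<in> {..<4 ^ K}"
        using g_less[of "fst x" "snd x"] by (simp add: mem_Times_iff)
    qed
  qed simp_all
  also have "\<dots> = (\<Sum>k<K. \<Sum>m<K. T (k, m))"
    unfolding sum.cartesian_product by (intro sum.cong) auto
  finally show ?thesis
    by (simp add: cblinop_apply_sum_left T_def rank_one_apply scaleC_scaleC scaleC_sum_left)
qed

text \<open>Along the cut-offs \<open>4 ^ K\<close> the partial sums are products of a diagonal
  contraction, a finite Hilbert matrix of norm at most \<open>pi\<close>, and the same contraction.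
  The bound passes to the limit.\<close>

lemma norm_hilbert_symbol_le:
  assumes e: "orthonormal_on UNIV e" and z: "z \<in> ball 0 1"
  shows "norm (hilbert_symbol e z) \<le> pi"
proof (rule Lim_bounded)
  have "(\<lambda>N. \<Sum>n<N. z ^ n *\<^sub>C hilbert_coeff e n) \<longlonglongrightarrow> hilbert_symbol e z"
    using has_power_series_hilbert_symbol[OF e] z by (simp add: has_power_series_on_disc_def sums_def)
  from LIMSEQ_subseq_LIMSEQ[OF this, of "\<lambda>K. 4 ^ K"]
  have "(\<lambda>K. \<Sum>n<4 ^ K. z ^ n *\<^sub>C hilbert_coeff e n) \<longlonglongrightarrow> hilbert_symbol e z"
    by (simp add: strict_mono_def o_def)
  then show "(\<lambda>K. norm (\<Sum>n<4 ^ K. z ^ n *\<^sub>C hilbert_coeff e n)) \<longlonglongrightarrow> norm (hilbert_symbol e z)"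
    by (rule tendsto_norm)
  show "\<forall>K\<ge>0. norm (\<Sum>n<4 ^ K. z ^ n *\<^sub>C hilbert_coeff e n) \<le> pi"
  proof (intro allI impI norm_cblinop_le)
    fix K :: nat and x :: 'a
    have e': "orthonormal_on {..<K} e"
      using e by (rule orthonormal_on_subset) simp
    have z1: "cmod (z ^ n) \<le> 1" for n
      using z by (simp add: norm_power power_le_one)
    have damp: "(cmod (z ^ n * c))\<^sup>2 \<le> (cmod c)\<^sup>2" for n c
      using mult_right_mono[OF z1[of n] norm_ge_zero[of c]] by (intro power_mono) (auto simp: norm_mult)
    define c where "c = (\<lambda>k. \<Sum>m<K. z ^ (4 ^ m) * cinner x (e m) / of_int (int k - int m))"
    have "cblinop_apply (\<Sum>n<4 ^ K. z ^ n *\<^sub>C hilbert_coeff e n) x = (\<Sum>k<K. (z ^ (4 ^ k) * c k) *\<^sub>C e k)"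
      unfolding hilbert_partial_sum_apply
      by (simp add: c_def sum_distrib_left power_add mult.assoc)
    then have "(norm (cblinop_apply (\<Sum>n<4 ^ K. z ^ n *\<^sub>C hilbert_coeff e n) x))\<^sup>2
        = (\<Sum>k<K. (cmod (z ^ (4 ^ k) * c k))\<^sup>2)"
      by (simp only: norm_orthonormal_sum[OF e' finite_lessThan])
    also have "\<dots> \<le> (\<Sum>k<K. (cmod (c k))\<^sup>2)"
      by (intro sum_mono damp)
    also have "\<dots> \<le> pi\<^sup>2 * (\<Sum>m<K. (cmod (z ^ (4 ^ m) * cinner x (e m)))\<^sup>2)"
      unfolding c_def by (rule Hilbert_inequality)
    also have "\<dots> \<le> pi\<^sup>2 * (\<Sum>m<K. (cmod (cinner x (e m)))\<^sup>2)"
      by (intro mult_left_mono sum_mono damp) auto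
    also have "\<dots> \<le> pi\<^sup>2 * (norm x)\<^sup>2"
      by (intro mult_left_mono Bessel_inequality[OF e']) auto
    finally show "norm (cblinop_apply (\<Sum>n<4 ^ K. z ^ n *\<^sub>C hilbert_coeff e n) x) \<le> pi * norm x"
      unfolding power_mult_distrib[symmetric] by (rule power2_le_imp_le) simp
  qed simp
qed

text \<open>The argument \<open>y K\<close> may move with the cut-off: for the upper bound it is a
  Taylor polynomial of \<open>f\<close> at \<open>z\<close>, so that everything becomes polynomial
  at once; for the lower bound it is constant.\<close>

lemma D_op_hilbert_symbol_apply_tendsto:
  assumes e: "orthonormal_on UNIV e" and z: "z \<in> ball 0 1" and y: "y \<longlonglongrightarrow> x"
  shows "(\<lambda>K. \<Sum>k<K. (\<Sum>m<K. of_nat (Suc (4 ^ k + 4 ^ m)) * z ^ (4 ^ k + 4 ^ m) * cinner (y K) (e m)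
    / of_int (int k - int m)) *\<^sub>C e k) \<longlonglongrightarrow> cblinop_apply (D_op (hilbert_symbol e) z) x"
proof -
  have "(\<lambda>N. \<Sum>n<N. z ^ n *\<^sub>C of_nat (Suc n) *\<^sub>C hilbert_coeff e n) \<longlonglongrightarrow> D_op (hilbert_symbol e) z"
    using has_power_series_D_op[OF has_power_series_hilbert_symbol[OF e] z] by (simp add: sums_def)
  from LIMSEQ_subseq_LIMSEQ[OF this, of "\<lambda>K. 4 ^ K"]
  have "(\<lambda>K. \<Sum>n<4 ^ K. z ^ n *\<^sub>C of_nat (Suc n) *\<^sub>C hilbert_coeff e n) \<longlonglongrightarrow> D_op (hilbert_symbol e) z"
    by (simp add: strict_mono_def o_def)
  then have "(\<lambda>K. cblinop_apply (\<Sum>n<4 ^ K. (of_nat (Suc n) * z ^ n) *\<^sub>C hilbert_coeff e n) (y K))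
      \<longlonglongrightarrow> cblinop_apply (D_op (hilbert_symbol e) z) x"
    using bounded_bilinear.tendsto[OF bounded_bilinear_cblinop_apply _ y]
    by (simp add: scaleC_scaleC mult.commute)
  then show ?thesis
    by (simp only: hilbert_partial_sum_apply)
qed

text \<open>Fatou's lemma reduces the claim to finite truncations of rows, columns and Taylor series
  by the same \<open>K\<close>, where \<open>nn_integral_disc_hilbert_poly\<close> applies. Bessel's
  inequality for each Taylor coefficient bounds the double sum by the squared \<open>H^2\<close>
  norm of \<open>f\<close>, which is \<open>1\<close>.\<close>

lemma hilbert_symbol_analytic_bound:
  fixes f :: "complex \<Rightarrow> 'a::complex_hilbert_space"
  assumes e: "orthonormal_on UNIV e" and f: "f \<in> O1"
  shows "(\<integral>\<^sup>+z\<in>ball 0 1. ennreal ((norm (cblinop_apply (D_op (hilbert_symbol e) z) (f z)))\<^sup>2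
    * (1 - (cmod z)\<^sup>2)) \<partial>lborel) \<le> ennreal (10 * pi ^ 3)"
proof -
  obtain c R where R: "R > 1" and ps: "has_power_series_on_disc f c R"
    and c: "(\<lambda>n. (norm (c n))\<^sup>2) sums 1"
    using f by (auto simp: O1_def)
  define b where "b = (\<lambda>l m. cinner (c l) (e m))"
  define S where "S = (\<lambda>K z. \<Sum>k<K. (cmod (\<Sum>m<K. of_nat (Suc (4 ^ k + 4 ^ m)) * z ^ (4 ^ k + 4 ^ m)
      * (\<Sum>l<K. b l m * z ^ l) / of_int (int k - int m)))\<^sup>2)"
  define G where "G = (\<lambda>K z. ennreal (S K z * (1 - (cmod z)\<^sup>2)) * indicator (ball 0 1) z)"
  have [measurable]: "ball (0::complex) 1 \<in> sets borel"
    by simp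
  have [measurable]: "(\<lambda>z. S K z * (1 - (cmod z)\<^sup>2)) \<in> borel_measurable borel" for K
    unfolding S_def divide_inverse by (auto intro!: borel_measurable_continuous_onI continuous_intros)
  have G_meas: "G K \<in> borel_measurable lborel" for K
    unfolding G_def by simp
  have lim: "(\<lambda>K. G K z) \<longlonglongrightarrow> ennreal ((norm (cblinop_apply (D_op (hilbert_symbol e) z) (f z)))\<^sup>2
      * (1 - (cmod z)\<^sup>2)) * indicator (ball 0 1) z" for z
  proof (cases "z \<in> ball 0 1")
    case True
    define y where "y = (\<lambda>K. \<Sum>l<K. z ^ l *\<^sub>C c l)"
    define a where "a = (\<lambda>K k. \<Sum>m<K. of_nat (Suc (4 ^ k + 4 ^ m)) * z ^ (4 ^ k + 4 ^ m) * cinner (y K) (e m)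
        / of_int (int k - int m))"
    have "y \<longlonglongrightarrow> f z"
      using ps True R by (auto simp: has_power_series_on_disc_def sums_def y_def)
    from D_op_hilbert_symbol_apply_tendsto[OF e True this]
    have "(\<lambda>K. \<Sum>k<K. a K k *\<^sub>C e k) \<longlonglongrightarrow> cblinop_apply (D_op (hilbert_symbol e) z) (f z)"
      by (simp only: a_def)
    then have "(\<lambda>K. (norm (\<Sum>k<K. a K k *\<^sub>C e k))\<^sup>2 * (1 - (cmod z)\<^sup>2))
        \<longlonglongrightarrow> (norm (cblinop_apply (D_op (hilbert_symbol e) z) (f z)))\<^sup>2 * (1 - (cmod z)\<^sup>2)"
      by (intro tendsto_intros)
    moreover have "(norm (\<Sum>k<K. a K k *\<^sub>C e k))\<^sup>2 = S K z" for K
    proof -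
      have "orthonormal_on {..<K} e"
        using e by (rule orthonormal_on_subset) simp
      then have "(norm (\<Sum>k<K. a K k *\<^sub>C e k))\<^sup>2 = (\<Sum>k<K. (cmod (a K k))\<^sup>2)"
        by (simp add: norm_orthonormal_sum)
      moreover have "cinner (y K) (e m) = (\<Sum>l<K. b l m * z ^ l)" for m
        by (simp add: y_def b_def cinner_sum_left cinner_scaleC_left mult.commute)
      ultimately show ?thesis
        by (simp only: S_def a_def)
    qed
    ultimately show ?thesis
      using True by (auto simp: G_def intro!: tendsto_ennrealI)
  qed (simp add: G_def)
  have "(\<integral>\<^sup>+z. G K z \<partial>lborel) \<le> ennreal (10 * pi ^ 3)" for K
  proof -
    have "(\<Sum>l<K. \<Sum>m<K. (cmod (b l m))\<^sup>2) \<le> (\<Sum>l<K. (norm (c l))\<^sup>2)"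
      unfolding b_def using orthonormal_on_subset[OF e]
      by (intro sum_mono Bessel_inequality) auto
    also have "\<dots> \<le> (\<Sum>l. (norm (c l))\<^sup>2)"
      using c by (intro sum_le_suminf) (auto simp: sums_iff)
    also have "\<dots> = 1"
      using c by (simp add: sums_iff)
    finally have "10 * pi ^ 3 * (\<Sum>l<K. \<Sum>m<K. (cmod (b l m))\<^sup>2) \<le> 10 * pi ^ 3 * 1"
      by (intro mult_left_mono) auto
    then have "ennreal (10 * pi ^ 3 * (\<Sum>l<K. \<Sum>m<K. (cmod (b l m))\<^sup>2)) \<le> ennreal (10 * pi ^ 3)"
      by (intro ennreal_leI) simp
    moreover have "(\<integral>\<^sup>+z. G K z \<partial>lborel) \<le> ennreal (10 * pi ^ 3 * (\<Sum>l<K. \<Sum>m<K. (cmod (b l m))\<^sup>2))"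
      unfolding G_def S_def by (rule nn_integral_disc_hilbert_poly) simp
    ultimately show ?thesis
      by (rule order_trans[rotated])
  qed
  then have "liminf (\<lambda>K. \<integral>\<^sup>+z. G K z \<partial>lborel) \<le> ennreal (10 * pi ^ 3)"
    by (intro Liminf_le) (auto intro: always_eventually)
  moreover have "(\<integral>\<^sup>+z. liminf (\<lambda>K. G K z) \<partial>lborel) \<le> liminf (\<lambda>K. \<integral>\<^sup>+z. G K z \<partial>lborel)"
    by (rule nn_integral_liminf) (rule G_meas)
  moreover have "liminf (\<lambda>K. G K z) = ennreal ((norm (cblinop_apply (D_op (hilbert_symbol e) z) (f z)))\<^sup>2
      * (1 - (cmod z)\<^sup>2)) * indicator (ball 0 1) z" for z
    by (intro lim_imp_Liminf lim) simp
  ultimately show ?thesis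
    by simp
qed

section \<open>Lacunary test functions and the lower bound\<close>

definition lacunary_sum :: "(nat \<Rightarrow> 'a::complex_hilbert_space) \<Rightarrow> nat \<Rightarrow> complex \<Rightarrow> 'a"
  where "lacunary_sum e N z = (\<Sum>m<N. (of_real (1 / sqrt (real N)) * z ^ (4 ^ m)) *\<^sub>C e m)"

lemma lacunary_sum_in_O1:
  assumes e: "orthonormal_on UNIV e" and N: "0 < N"
  shows "lacunary_sum e N \<in> O1"
proof -
  define \<alpha> where "\<alpha> = complex_of_real (1 / sqrt (real N))"
  define a where "a = (\<lambda>n m. if n = (4 :: nat) ^ m then \<alpha> else 0)"
  define c where "c = (\<lambda>n. \<Sum>m<N. a n m *\<^sub>C e m)"
  have "(\<lambda>n. z ^ n *\<^sub>C c n) sums lacunary_sum e N z" for z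
  proof -
    have "(\<lambda>n. \<Sum>m<N. if n = 4 ^ m then (\<alpha> * z ^ n) *\<^sub>C e m else 0) sums (\<Sum>m<N. (\<alpha> * z ^ (4 ^ m)) *\<^sub>C e m)"
      by (intro sums_sum sums_single)
    moreover have "(\<Sum>m<N. if n = 4 ^ m then (\<alpha> * z ^ n) *\<^sub>C e m else 0) = z ^ n *\<^sub>C c n" for n
      unfolding c_def scaleC_sum_right by (intro sum.cong) (auto simp: a_def scaleC_scaleC mult.commute)
    ultimately show ?thesis
      by (simp add: lacunary_sum_def \<alpha>_def)
  qed
  \<comment> \<open>The function is a polynomial, so any radius above \<open>1\<close>
    serves.\<close>
  then have "has_power_series_on_disc (lacunary_sum e N) c 2"
    by (simp add: has_power_series_on_disc_def)
  moreover have "(\<lambda>n. (norm (c n))\<^sup>2) sums 1"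
  proof -
    have "orthonormal_on {..<N} e"
      using e by (rule orthonormal_on_subset) simp
    then have "(norm (c n))\<^sup>2 = (\<Sum>m<N. (cmod (a n m))\<^sup>2)" for n
      by (simp add: c_def norm_orthonormal_sum)
    also have "(\<Sum>m<N. (cmod (a n m))\<^sup>2) = (\<Sum>m<N. if n = 4 ^ m then 1 / real N else 0)" for n
      using N by (intro sum.cong) (auto simp: a_def \<alpha>_def norm_divide power_divide)
    finally have "(\<lambda>n. (norm (c n))\<^sup>2) = (\<lambda>n. \<Sum>m<N. if n = 4 ^ m then 1 / real N else 0)"
      by (simp add: fun_eq_iff)
    moreover have "(\<lambda>n. \<Sum>m<N. if n = 4 ^ m then 1 / real N else 0) sums (\<Sum>m<N. 1 / real N)"
      by (intro sums_sum sums_single)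
    ultimately show ?thesis
      using N by simp
  qed
  ultimately show ?thesis
    by (auto simp: O1_def intro!: exI[of _ c] exI[of _ 2])
qed

text \<open>The conjugation acts here: \<open>z ^ 4 ^ m * cnj z ^ 4 ^ m\<close> is a power of
  \<open>|z|^2\<close>, so every term of row \<open>k\<close> has the same phase, that of
  \<open>z ^ 4 ^ k\<close>, up to the sign of \<open>k - m\<close>. What remains is a real sum that
  can be estimated from below.\<close>

lemma cinner_hilbert_symbol_lacunary_sum:
  assumes e: "orthonormal_on UNIV e" and z: "z \<in> ball 0 1" and k: "k < N"
  shows "cinner (cblinop_apply (D_op (hilbert_symbol e) z) (lacunary_sum e N (cnj z))) (e k)
    = of_real (1 / sqrt (real N)) * z ^ (4 ^ k) * of_real (\<Sum>m<N. real (Suc (4 ^ k + 4 ^ m))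
        * ((cmod z)\<^sup>2) ^ (4 ^ m) / of_int (int k - int m))" (is "_ = ?r")
proof -
  define x where "x = lacunary_sum e N (cnj z)"
  define \<alpha> where "\<alpha> = complex_of_real (1 / sqrt (real N))"
  define a where "a = (\<lambda>K k. \<Sum>m<K. of_nat (Suc (4 ^ k + 4 ^ m)) * z ^ (4 ^ k + 4 ^ m) * cinner x (e m)
        / of_int (int k - int m))"
  have x_coeff: "cinner x (e m) = (if m < N then \<alpha> * cnj z ^ (4 ^ m) else 0)" for m
  proof -
    have "cinner x (e m) = (\<Sum>j<N. if m = j then \<alpha> * cnj z ^ (4 ^ m) else 0)"
      unfolding x_def lacunary_sum_def cinner_sum_left
      using e by (intro sum.cong) (auto simp: cinner_scaleC_left orthonormal_on_def \<alpha>_def)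
    then show ?thesis
      by simp
  qed
  have "(\<lambda>K. \<Sum>k<K. a K k *\<^sub>C e k) \<longlonglongrightarrow> cblinop_apply (D_op (hilbert_symbol e) z) x"
    using D_op_hilbert_symbol_apply_tendsto[OF e z tendsto_const[of x]] by (simp only: a_def)
  then have "(\<lambda>K. cinner (\<Sum>k<K. a K k *\<^sub>C e k) (e k)) \<longlonglongrightarrow> cinner (cblinop_apply (D_op (hilbert_symbol e) z) x) (e k)"
    by (rule bounded_bilinear.tendsto[OF bounded_bilinear_cinner _ tendsto_const])
  \<comment> \<open>The test vector has no components along \<open>e m\<close> for
    \<open>m \<ge> N\<close>, so this coordinate is constant once \<open>K \<ge> N\<close> and the
    limit is exact.\<close>
  moreover have "\<forall>\<^sub>F K in sequentially. cinner (\<Sum>k<K. a K k *\<^sub>C e k) (e k) = ?r"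
    using eventually_ge_at_top[of N]
  proof eventually_elim
    case (elim K)
    have "orthonormal_on {..<K} e"
      using e by (rule orthonormal_on_subset) simp
    then have "cinner (\<Sum>k<K. a K k *\<^sub>C e k) (e k) = a K k"
      using k elim by (intro cinner_orthonormal_sum) auto
    also have "\<dots> = a N k"
      unfolding a_def using elim by (intro sum.mono_neutral_right) (auto simp: x_coeff)
    also have "\<dots> = ?r"
    proof -
      have zz: "complex_of_real ((cmod z)\<^sup>2) ^ j = z ^ j * cnj z ^ j" for j
        by (simp only: complex_norm_square power_mult_distrib)
      have "a N k = (\<Sum>m<N. \<alpha> * z ^ (4 ^ k) * (of_nat (Suc (4 ^ k + 4 ^ m))
          * of_real ((cmod z)\<^sup>2) ^ (4 ^ m) / of_int (int k - int m)))"
        unfolding a_def zz by (intro sum.cong) (auto simp: x_coeff power_add mult_ac simp del: of_int_diff)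
      then show ?thesis
        by (simp add: sum_distrib_left \<alpha>_def del: of_int_diff)
    qed
    finally show ?case .
  qed
  ultimately have "(\<lambda>K. ?r) \<longlonglongrightarrow> cinner (cblinop_apply (D_op (hilbert_symbol e) z) x) (e k)"
    by (rule Lim_transform_eventually)
  then show ?thesis
    unfolding x_def by (simp only: LIMSEQ_const_iff)
qed

text \<open>Coordinate \<open>k\<close> is kept only on its annulus \<open>A k\<close>, where
  \<open>Hilbert_row_lower_bound\<close> applies, and Bessel's inequality adds the coordinates. The
  square of the row is of order \<open>16 ^ k / N\<close>, the weight and the area are each of order
  \<open>4 ^ (-k)\<close>, so the scales cancel and every row contributes equally up to the
  logarithm.\<close>

lemma hilbert_symbol_antianalytic_lower_bound:
  assumes e: "orthonormal_on UNIV e"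
  shows "ennreal (\<Sum>k<N. pi / (32 * real N) * (max 0 (harm k / 2 - 22))\<^sup>2)
    \<le> (\<integral>\<^sup>+z\<in>ball 0 1. ennreal ((norm (cblinop_apply (D_op (hilbert_symbol e) z)
        (lacunary_sum e N (cnj z))))\<^sup>2 * (1 - (cmod z)\<^sup>2)) \<partial>lborel)"
proof -
  define A where "A = (\<lambda>k. {z :: complex. 1 - 1 / (2 * 4 ^ k) < (cmod z)\<^sup>2 \<and> (cmod z)\<^sup>2 < 1 - 1 / (4 * 4 ^ k)})"
  define C where "C = (\<lambda>k. 4 ^ k / (8 * real N) * (max 0 (harm k / 2 - 22 :: real))\<^sup>2)"
  define x where "x = (\<lambda>z. cblinop_apply (D_op (hilbert_symbol e) z) (lacunary_sum e N (cnj z)))"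
  have C_nonneg: "0 \<le> C k" for k
    by (simp add: C_def)
  have A_open: "open (A k)" for k
    unfolding A_def by (intro open_Collect_conj open_Collect_less continuous_intros)
  have A_emeasure: "emeasure lborel (A k) = ennreal (pi / (4 * 4 ^ k))" for k
  proof -
    have "(1 :: real) \<le> 4 ^ k"
      by simp
    then have "(1 :: real) \<le> 2 * 4 ^ k"
      by linarith
    then have "1 / (2 * 4 ^ k) \<le> (1 :: real)"
      by simp
    then show ?thesis
      unfolding A_def by (subst emeasure_annulus) (auto simp: field_simps)
  qed
  have comp: "C k * indicator (A k) z \<le> (cmod (cinner (x z) (e k)))\<^sup>2 * (1 - (cmod z)\<^sup>2)"
    if z: "z \<in> ball 0 1" and k: "k < N" for z k
  proof (cases "z \<in> A k")
    case True
    define t where "t = (cmod z)\<^sup>2"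
    define d :: real where "d = 1 / (2 * 4 ^ k)"
    define \<sigma> where "\<sigma> = (\<Sum>m<N. real (Suc (4 ^ k + 4 ^ m)) * t ^ (4 ^ m) / of_int (int k - int m))"
    \<comment> \<open>Truncation at \<open>0\<close> lets the lower bound be squared; rows with a
      small harmonic number just contribute nothing.\<close>
    define h :: real where "h = max 0 (harm k / 2 - 22)"
    have t: "1 - 1 / (2 * 4 ^ k) < t" "t < 1 - 1 / (4 * 4 ^ k)"
      using True by (auto simp: A_def t_def)
    have "1 / (2 * 4 ^ k) \<le> (1 / 2 :: real)"
      by (simp add: field_simps)
    then have d: "0 < d" "d \<le> 1 / 2" "1 - d < t" "t < 1 - d / 2"
      using t by (simp_all add: d_def)
    have "4 ^ k * (harm k / 2 - 22) \<le> \<sigma>"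
      unfolding \<sigma>_def using k t by (rule Hilbert_row_lower_bound)
    then have "4 ^ k * h \<le> \<bar>\<sigma>\<bar>"
      by (auto simp: h_def max_def)
    then have "(4 ^ k * h)\<^sup>2 \<le> \<bar>\<sigma>\<bar>\<^sup>2"
      by (intro power_mono) (auto simp: h_def)
    moreover have "1 / 2 \<le> t ^ (4 ^ k)"
    proof -
      have "1 + real (4 ^ k) * (- d) \<le> (1 + - d) ^ (4 ^ k)"
        using d by (intro Bernoulli_inequality) linarith
      also have "\<dots> \<le> t ^ (4 ^ k)"
        using d by (intro power_mono) linarith+
      finally show ?thesis
        by (simp add: d_def)
    qed
    ultimately have "1 / real N * (1 / 2 * (4 ^ k * h)\<^sup>2) * (1 / (4 * 4 ^ k))
        \<le> 1 / real N * (t ^ (4 ^ k) * \<bar>\<sigma>\<bar>\<^sup>2) * (1 - t)"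
      using t by (intro mult_mono mult_nonneg_nonneg) auto
    moreover have "(cmod (cinner (x z) (e k)))\<^sup>2 = 1 / real N * (t ^ (4 ^ k) * \<bar>\<sigma>\<bar>\<^sup>2)"
    proof -
      have "(1 / sqrt (real N))\<^sup>2 = 1 / real N" "(cmod z ^ (4 ^ k))\<^sup>2 = t ^ (4 ^ k)"
        by (simp_all add: power_divide t_def power_mult[symmetric] mult.commute)
      then show ?thesis
        unfolding x_def cinner_hilbert_symbol_lacunary_sum[OF e z k] t_def[symmetric] \<sigma>_def[symmetric]
        by (simp only: norm_mult norm_power norm_of_real power_mult_distrib power2_abs mult.assoc)
    qed
    moreover have "1 / real N * (1 / 2 * (4 ^ k * h)\<^sup>2) * (1 / (4 * 4 ^ k)) = C k"
      by (simp add: C_def h_def power_mult_distrib power2_eq_square[of "4 ^ k"])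
    ultimately show ?thesis
      using True by (simp add: t_def)
  next
    case False
    have "(cmod z)\<^sup>2 \<le> 1"
      using z by (simp add: abs_square_le_1)
    with False show ?thesis
      by simp
  qed
  have "ennreal (\<Sum>k<N. pi / (32 * real N) * (max 0 (harm k / 2 - 22))\<^sup>2)
      = (\<Sum>k<N. ennreal (C k) * emeasure lborel (A k))"
  proof -
    have "pi / (32 * real N) * (max 0 (harm k / 2 - 22))\<^sup>2 = C k * (pi / (4 * 4 ^ k))" for k
      by (simp add: C_def)
    then show ?thesis
      unfolding A_emeasure using C_nonneg by (simp add: ennreal_mult[symmetric] sum_ennreal)
  qed
  also have "\<dots> = (\<integral>\<^sup>+z. (\<Sum>k<N. ennreal (C k) * indicator (A k) z) \<partial>lborel)"
  proof -
    have A_sets: "A k \<in> sets lborel" for k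
      using A_open by (simp add: borel_open)
    have "(\<integral>\<^sup>+z. (\<Sum>k<N. ennreal (C k) * indicator (A k) z) \<partial>lborel)
        = (\<Sum>k<N. \<integral>\<^sup>+z. ennreal (C k) * indicator (A k) z \<partial>lborel)"
      by (intro nn_integral_sum borel_measurable_times_ennreal borel_measurable_const
          borel_measurable_indicator A_sets)
    then show ?thesis
      by (simp only: nn_integral_cmult_indicator[OF A_sets])
  qed
  also have "\<dots> \<le> (\<integral>\<^sup>+z\<in>ball 0 1. ennreal ((norm (x z))\<^sup>2 * (1 - (cmod z)\<^sup>2)) \<partial>lborel)"
  proof (rule nn_integral_mono)
    fix z
    show "(\<Sum>k<N. ennreal (C k) * indicator (A k) z)
        \<le> ennreal ((norm (x z))\<^sup>2 * (1 - (cmod z)\<^sup>2)) * indicator (ball 0 1) z"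
    proof (cases "z \<in> ball 0 1")
      case True
      have "(\<Sum>k<N. C k * indicator (A k) z) \<le> (\<Sum>k<N. (cmod (cinner (x z) (e k)))\<^sup>2 * (1 - (cmod z)\<^sup>2))"
        by (intro sum_mono comp[OF True]) simp
      also have "\<dots> = (\<Sum>k<N. (cmod (cinner (x z) (e k)))\<^sup>2) * (1 - (cmod z)\<^sup>2)"
        by (simp only: sum_distrib_right)
      also have "\<dots> \<le> (norm (x z))\<^sup>2 * (1 - (cmod z)\<^sup>2)"
        using True orthonormal_on_subset[OF e]
        by (intro mult_right_mono Bessel_inequality) (auto simp: abs_square_le_1)
      finally have "ennreal (\<Sum>k<N. C k * indicator (A k) z) \<le> ennreal ((norm (x z))\<^sup>2 * (1 - (cmod z)\<^sup>2))"
        by (rule ennreal_leI)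
      moreover have "(\<Sum>k<N. ennreal (C k) * indicator (A k) z) = ennreal (\<Sum>k<N. C k * indicator (A k) z)"
      proof -
        have "ennreal (C k) * indicator (A k) z = ennreal (C k * indicator (A k) z)" for k
          by (simp add: indicator_def)
        then show ?thesis
          by (simp only:) (rule sum_ennreal, simp add: C_nonneg)
      qed
      ultimately show ?thesis
        using True by simp
    next
      case False
      have "z \<notin> A k" for k
      proof
        assume "z \<in> A k"
        then have "(cmod z)\<^sup>2 < 1 - 1 / (4 * 4 ^ k)"
          by (simp add: A_def)
        also have "\<dots> \<le> 1"
          by simp
        finally show False
          using False by (simp add: abs_square_less_1)
      qed
      then show ?thesis
        by simp
    qed
  qed
  finally show ?thesis
    by (simp only: x_def)
qed

lemma harm_unbounded: "\<exists>n. B \<le> (harm n :: real)"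
proof (rule ccontr)
  assume "\<not> (\<exists>n. B \<le> (harm n :: real))"
  then have "norm (harm n :: real) \<le> B" for n
    using harm_nonneg[of n, where 'a = real] by (auto simp: not_le intro: less_imp_le)
  then have "convergent (harm :: nat \<Rightarrow> real)"
    by (intro Bseq_mono_convergent BseqI') (auto intro: harm_mono)
  then show False
    using not_convergent_harm by blast
qed

theorem corollary1p11:
  assumes separable: "separable_space (euclidean :: 'a::complex_hilbert_space topology)"
    and infinite_dim: "\<not> (\<exists>B :: 'a set. finite B \<and> cspan B = UNIV)"
  shows "\<exists>\<phi> :: complex \<Rightarrow> 'a cblinop.
    analytic_on_disc \<phi> 1 \<and> bounded (\<phi> ` ball 0 1) \<and>
    (SUP f\<in>O1. \<integral>\<^sup>+z\<in>ball 0 1.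
        ennreal ((norm (cblinop_apply (D_op \<phi> z) (f z)))\<^sup>2 * (1 - (cmod z)\<^sup>2)) \<partial>lborel) < \<infinity> \<and>
    (SUP f\<in>O1. \<integral>\<^sup>+z\<in>ball 0 1.
        ennreal ((norm (cblinop_apply (D_op \<phi> z) (f (cnj z))))\<^sup>2 * (1 - (cmod z)\<^sup>2)) \<partial>lborel) = \<infinity>"
proof -
  obtain e :: "nat \<Rightarrow> 'a" where e: "orthonormal_on UNIV e"
    using exists_orthonormal_sequence[OF infinite_dim] by blast
  have "analytic_on_disc (hilbert_symbol e) 1"
    using has_power_series_hilbert_symbol[OF e] by (auto simp: analytic_on_disc_def)
  moreover have "bounded (hilbert_symbol e ` ball 0 1)"
    using norm_hilbert_symbol_le[OF e] by (intro boundedI[of _ pi]) auto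
  moreover have "(SUP f\<in>O1. \<integral>\<^sup>+z\<in>ball 0 1. ennreal ((norm (cblinop_apply (D_op (hilbert_symbol e) z) (f z)))\<^sup>2
      * (1 - (cmod z)\<^sup>2)) \<partial>lborel) \<le> ennreal (10 * pi ^ 3)"
    by (intro SUP_least hilbert_symbol_analytic_bound[OF e])
  then have "(SUP f\<in>O1. \<integral>\<^sup>+z\<in>ball 0 1. ennreal ((norm (cblinop_apply (D_op (hilbert_symbol e) z) (f z)))\<^sup>2
      * (1 - (cmod z)\<^sup>2)) \<partial>lborel) < \<infinity>"
    by (rule le_less_trans) simp
  moreover have "(SUP f\<in>O1. \<integral>\<^sup>+z\<in>ball 0 1. ennreal ((norm (cblinop_apply (D_op (hilbert_symbol e) z) (f (cnj z))))\<^sup>2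
      * (1 - (cmod z)\<^sup>2)) \<partial>lborel) = top"
  proof (rule ennreal_SUP_eq_top)
    fix n :: nat
    \<comment> \<open>Beyond \<open>P0\<close> the logarithmic factor is at least
      \<open>H = 64 * n + 1\<close>. With \<open>N = 2 * P\<close> the upper half of the rows
      carries it, and \<open>P\<close> rows of size \<open>pi / (32 * 2 * P) * H^2\<close> total
      \<open>pi / 64 * H^2\<close>. The \<open>64\<close> makes this at least \<open>n\<close>; the
      \<open>+ 1\<close> gives \<open>H \<le> H^2\<close>.\<close>
    obtain P0 where P0: "2 * (64 * real n + 1 + 22) \<le> (harm P0 :: real)"
      using harm_unbounded by blast
    define P where "P = Suc P0"
    define H :: real where "H = 64 * real n + 1"
    have P: "H \<le> harm k / 2 - 22" if "P \<le> k" for k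
      using harm_mono[of P0 k, where 'a = real] that P0 by (simp add: P_def H_def)
    have "real n \<le> pi / 64 * H"
    proof -
      have "1 * real n \<le> pi * real n"
        using pi_gt3 by (intro mult_right_mono) auto
      moreover have "pi / 64 * H = pi * real n + pi / 64"
        by (simp add: H_def field_simps)
      ultimately show ?thesis
        using pi_gt_zero by linarith
    qed
    also have "\<dots> \<le> pi / 64 * H\<^sup>2"
    proof (rule mult_left_mono)
      have "H * 1 \<le> H * H"
        by (intro mult_left_mono) (auto simp: H_def)
      then show "H \<le> H\<^sup>2"
        by (simp add: power2_eq_square)
    qed simp
    also have "\<dots> = (\<Sum>k\<in>{P..<2 * P}. pi / (32 * real (2 * P)) * H\<^sup>2)"
    proof -
      have "card {P..<2 * P} = P" "0 < P"
        by (simp_all add: P_def)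
      then show ?thesis
        by (simp add: sum_constant)
    qed
    also have "\<dots> \<le> (\<Sum>k\<in>{P..<2 * P}. pi / (32 * real (2 * P)) * (max 0 (harm k / 2 - 22))\<^sup>2)"
    proof (intro sum_mono mult_left_mono power_mono)
      show "H \<le> max 0 (harm k / 2 - 22)" if "k \<in> {P..<2 * P}" for k
        using P[of k] that by simp
      show "0 \<le> H"
        by (simp add: H_def)
    qed simp
    also have "\<dots> \<le> (\<Sum>k<2 * P. pi / (32 * real (2 * P)) * (max 0 (harm k / 2 - 22))\<^sup>2)"
      by (intro sum_mono2) auto
    finally have "of_nat n \<le> ennreal (\<Sum>k<2 * P. pi / (32 * real (2 * P)) * (max 0 (harm k / 2 - 22))\<^sup>2)"
      by (simp only: ennreal_of_nat_eq_real_of_nat ennreal_leI)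
    also note hilbert_symbol_antianalytic_lower_bound[OF e]
    finally show "\<exists>f\<in>O1. of_nat n \<le> (\<integral>\<^sup>+z\<in>ball 0 1. ennreal ((norm (cblinop_apply (D_op (hilbert_symbol e) z)
        (f (cnj z))))\<^sup>2 * (1 - (cmod z)\<^sup>2)) \<partial>lborel)"
      using lacunary_sum_in_O1[OF e, of "2 * P"] by (auto simp: P_def)
  qed
  ultimately show ?thesis
    by auto
qed

end
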